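(* Let $\rho_0\in\mathcal{P}_2(\mathbb{R})$ and $v_0\in L^2(\rho_0)$, let $N_0$ be the optimal map of $\rho_0$, $V_0=v_0\circ N_0$, and $F(x)=\int_0^x V_0(w)\,dw$ for $x\in[0,1]$. Assume that $V_0$ is not a.e. equal to $0$. Let $$\mathcal I=\{[a,b]\subseteq[0,1]\ :\ F(a)=F(b)=0,\ F(x)>0\ \text{ for all } x\in(a,b)\}$$ (intervals with $a<b$). If the sticky particle solution of the pressureless Euler system originating at $(N_0,V_0)$ goes to equilibrium, then its (potentially infinite) time of collapse is $$T_c=\sup_{[a,b]\in\mathcal I}\ \sup_{x\in(a,b)}\ \frac{\displaystyle\int_x^b N_0(w)\,dw+\frac{x-b}{b-a}\int_a^b N_0(w)\,dw}{\displaystyle\int_0^x V_0(w)\,dw}.$$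
   Context: $\mathcal{P}_2(\mathbb{R})$ is the set of Borel probability measures on $\mathbb{R}$ with finite second moment; $\mathcal{L}$ is Lebesgue measure on $(0,1)$; $W_1$ is the 1-Wasserstein distance. The optimal map of a probability measure $\mu$ on $\mathbb{R}$ is the unique nondecreasing right-continuous function $N$ on $(0,1)$ with $N_\#\mathcal{L}=\mu$ (push-forward). If $\mu_1,\mu_2$ have optimal maps $N_1,N_2$, then $W_1(\mu_1,\mu_2)=\|N_1-N_2\|_{L^1(0,1)}$. The pressureless Euler system in one dimension is $\partial_t\rho+\partial_y(\rho v)=0$, $\partial_t(\rho v)+\partial_y(\rho v^2)=0$. Let $\mathcal{K}\subset L^2(0,1)$ be the closed convex cone of (a.e. classes of) nondecreasing functions and $\operatorname{proj}_{\mathcal K}$ the $L^2(0,1)$-orthogonal projection onto $\mathcal K$. It is computed by $\operatorname{proj}_{\mathcal K}f(x)=\frac{d^+}{dx}\Phi^{**}(x)$, where $\Phi(x)=\int_0^x f(w)\,dw$, $\Phi^{**}$ is the convex envelope of $\Phi$ on $[0,1]$ (greatest convex function bounded above by $\Phi$), and $\frac{d^+}{dx}$ is the right derivative; this nondecreasing right-continuous representative is always used. "The sticky particle solution" originating at $(N_0,V_0)$ means the solution generated by the projection formula: $N_t=\operatorname{proj}_{\mathcal K}(N_0+tV_0)$ and $\rho_t=(N_t)_\#\mathcal{L}$ for $t\ge0$. The solution converges (goes) to equilibrium if $W_1(\rho_t,\rho_\infty)\to0$ as $t\to\infty$ for some $\rho_\infty\in\mathcal{P}_2(\mathbb{R})$;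 equivalently $\|N_t-N_\infty\|_{L^1(0,1)}\to0$ for some $N_\infty\in L^2(0,1)$. If additionally there is $T\ge0$ with $\rho_t=\rho_\infty$ (i.e. $N_t=N_\infty$) for all $t\ge T$, the solution collapses to equilibrium in finite time, and the minimal such $T$ is the time of collapse. The time of collapse is $\infty$ if no such $T$ exists. *)

theory Defs
  imports "HOL-Probability.Probability"
begin

abbreviation unit_leb :: "real measure" where
  "unit_leb \<equiv> restrict_space lborel {0<..<1}"

definition square_integrable :: "'a measure \<Rightarrow> ('a \<Rightarrow> real) \<Rightarrow> bool" where
  "square_integrable M f \<longleftrightarrow> f \<in> borel_measurable M \<and> integrable M (\<lambda>x. (f x)\<^sup>2)"

definition P2 :: "real measure set" where
  "P2 = {\<mu>. real_distribution \<mu> \<and> integrable \<mu> (\<lambda>y. y\<^sup>2)}"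

definition couplings :: "real measure \<Rightarrow> real measure \<Rightarrow> (real \<times> real) measure set" where
  "couplings \<mu> \<nu> =
     {\<pi>. sets \<pi> = sets borel \<and> distr \<pi> borel fst = \<mu> \<and> distr \<pi> borel snd = \<nu>}"

definition W1 :: "real measure \<Rightarrow> real measure \<Rightarrow> ennreal" where
  "W1 \<mu> \<nu> = (INF \<pi>\<in>couplings \<mu> \<nu>. \<integral>\<^sup>+ p. ennreal \<bar>fst p - snd p\<bar> \<partial>\<pi>)"

definition right_continuous_01 :: "(real \<Rightarrow> real) \<Rightarrow> bool" where
  "right_continuous_01 g \<longleftrightarrow> (\<forall>x\<in>{0<..<1}. continuous (at_right x) g)"

(* Only the values of N on (0,1) matter; monotonicity there makes N measurable
   for unit_leb, so the push-forward is a genuine one. *)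
definition optimal_map :: "real measure \<Rightarrow> (real \<Rightarrow> real) \<Rightarrow> bool" where
  "optimal_map \<mu> N \<longleftrightarrow>
     mono_on {0<..<1} N \<and> right_continuous_01 N \<and> distr unit_leb borel N = \<mu>"

(* The cone K, with every class in L^2(0,1) represented by its nondecreasing members. *)
definition mono_cone :: "(real \<Rightarrow> real) set" where
  "mono_cone = {g. square_integrable unit_leb g \<and> mono_on {0<..<1} g}"

(* The L^2(0,1)-orthogonal projection onto K: the nearest point of K, represented by its
   right-continuous nondecreasing member. The value 0 outside (0,1) is a pure convention
   that makes this representative unique as a function on the whole real line. *)
definition proj_mono :: "(real \<Rightarrow> real) \<Rightarrow> real \<Rightarrow> real" where
  "proj_mono f = (THE g. g \<in> mono_cone \<and> right_continuous_01 g \<and> (\<forall>x. x \<notin> {0<..<1} \<longrightarrow> g x = 0) \<and>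
     (\<forall>h\<in>mono_cone. (LINT x|unit_leb. (f x - g x)\<^sup>2) \<le> (LINT x|unit_leb. (f x - h x)\<^sup>2)))"

definition sticky_map :: "(real \<Rightarrow> real) \<Rightarrow> (real \<Rightarrow> real) \<Rightarrow> real \<Rightarrow> real \<Rightarrow> real" where
  "sticky_map N0 V0 t = proj_mono (\<lambda>x. N0 x + t * V0 x)"

definition sticky_solution :: "(real \<Rightarrow> real) \<Rightarrow> (real \<Rightarrow> real) \<Rightarrow> real \<Rightarrow> real measure" where
  "sticky_solution N0 V0 t = distr unit_leb borel (sticky_map N0 V0 t)"

definition converges_to_equilibrium :: "(real \<Rightarrow> real measure) \<Rightarrow> real measure \<Rightarrow> bool" where
  "converges_to_equilibrium \<rho> \<rho>inf \<longleftrightarrow>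
     \<rho>inf \<in> P2 \<and> ((\<lambda>t. W1 (\<rho> t) \<rho>inf) \<longlongrightarrow> 0) at_top"

definition goes_to_equilibrium :: "(real \<Rightarrow> real measure) \<Rightarrow> bool" where
  "goes_to_equilibrium \<rho> \<longleftrightarrow> (\<exists>\<rho>inf. converges_to_equilibrium \<rho> \<rho>inf)"

definition collapsed_from :: "(real \<Rightarrow> real measure) \<Rightarrow> real \<Rightarrow> bool" where
  "collapsed_from \<rho> T \<longleftrightarrow>
     0 \<le> T \<and> (\<exists>\<rho>inf. converges_to_equilibrium \<rho> \<rho>inf \<and> (\<forall>t\<ge>T. \<rho> t = \<rho>inf))"

definition collapse_time :: "(real \<Rightarrow> real measure) \<Rightarrow> ereal" where
  "collapse_time \<rho> =
     (if \<exists>T. collapsed_from \<rho> T then ereal (LEAST T. collapsed_from \<rho> T) else \<infinity>)"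

end

theory Submission imports Defs begin

text \<open>
  Write \<open>\<Phi> t\<close> for the primitive of \<open>N0 + t * V0\<close> that vanishes at \<open>0\<close>, so that \<open>\<Phi> t = \<Phi> 0 + t * F\<close> with \<open>\<Phi> 0\<close>
  convex, and \<open>G t\<close> for the primitive of the sticky particle map at time \<open>t\<close>. The
  projection formula says that \<open>G t\<close> is the convex envelope of \<open>\<Phi> t\<close>. Since the projection is given
  here as a nearest point, its existence and the properties of an envelope are derived: \<open>G t\<close> lies below \<open>\<Phi> t\<close>,
  meets it at \<open>1\<close> (\<open>primitive_proj_mono_le\<close>), and dominates every primitive of a nondecreasing square
  integrable function below \<open>\<Phi> t\<close> (\<open>primitive_le_proj_mono\<close>). The first two follow from the first variation of the
  squared distance; maximality also uses the inequality \<open>\<integral> u k = - \<integral> U dk \<le> 0\<close> for nondecreasing \<open>k\<close> and \<open>U \<ge> 0\<close> the primitive of \<open>u\<close>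
  with \<open>U 1 = 0\<close> (\<open>monotone_pairing_nonpos\<close>).

  If the solution goes to equilibrium, the maps are bounded in \<open>L\<^sup>1\<close> for large times, so \<open>G t\<close> is bounded while
  \<open>G t \<le> \<Phi> 0 + t * F\<close>. This forces \<open>F \<ge> 0\<close> and \<open>F 1 = 0\<close> (\<open>equilibrium_imp_velocity\<close>). Then \<open>\<Phi> t\<close> stays fixed where
  \<open>F = 0\<close> and grows without bound on each component \<open>{a<..<b}\<close> of \<open>{F > 0}\<close>, and these components are the members
  of \<open>I\<close>. So \<open>G t\<close> rises towards the chord of \<open>\<Phi> 0\<close> over each such interval.
  The chord is reached by time \<open>T\<close> exactly when it lies below \<open>\<Phi> T\<close>, that is, when \<open>T * F\<close> is at least the
  gap between the chord and \<open>\<Phi> 0\<close>; this gap is the numerator of the quotient in the theorem.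

  The limiting map is not constructed. If the chords lie below \<open>\<Phi> T\<close>, then convexity gives \<open>G t \<le> \<Phi> T\<close> for all later
  \<open>t\<close>, and the maximality of \<open>G T\<close> gives \<open>G t = G T\<close> (\<open>map_eq_if_gap_le\<close>). If the map is constant from time \<open>T\<close> on, then
  \<open>G T = G t\<close> for arbitrarily large \<open>t\<close>, and the maximality of \<open>G t\<close> places it above the chords of \<open>\<Phi> 0\<close> over
  intervals slightly inside \<open>{a<..<b}\<close> (\<open>gap_le_if_constant\<close>). By uniqueness of optimal maps, constancy of the
  measures is constancy of the maps, so the times from which the solution has collapsed are the nonnegative upper
  bounds of the quotients (\<open>collapsed_from_iff_gap_le\<close>).
\<close>

section \<open>The unit interval as a probability space\<close>

lemma prob_space_unit_leb: "prob_space unit_leb"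
  by (rule prob_space_restrict_space) auto

interpretation unit_leb: prob_space unit_leb
  by (rule prob_space_unit_leb)

lemma space_unit_leb [simp]: "space unit_leb = {0<..<1}"
  by (simp add: space_restrict_space)

lemma measurable_unit_lebI: "f \<in> borel_measurable borel \<Longrightarrow> f \<in> borel_measurable unit_leb"
  by (simp add: measurable_restrict_space1)

lemma AE_unit_leb_iff: "(AE x in unit_leb. P x) \<longleftrightarrow> (AE x in lborel. x \<in> {0<..<1} \<longrightarrow> P x)"
  by (simp add: AE_restrict_space_iff)

lemma AE_unit_leb_countable: "countable C \<Longrightarrow> AE x in unit_leb. x \<notin> C"
  unfolding AE_unit_leb_iff
  by (rule AE_mp[OF AE_not_in[of C lborel]]) (auto intro: countable_imp_null_set_lborel)

lemma AE_unit_leb_not_eq: "AE w in unit_leb. w \<noteq> x"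
  using AE_unit_leb_countable[of "{x}"] by simp

text \<open>
  A property that holds almost everywhere holds on a dense set. Monotone and right-continuous
  functions are controlled from such a set.
\<close>
lemma AE_unit_leb_ex_between:
  assumes "AE x in unit_leb. P x" "0 \<le> a" "a < b" "b \<le> 1"
  shows "\<exists>x. a < x \<and> x < b \<and> P x"
proof (rule ccontr)
  assume "\<not> ?thesis"
  then have *: "a < x \<Longrightarrow> x < b \<Longrightarrow> \<not> P x" for x by blast
  have "AE x in lborel. x \<notin> {a<..<b}"
    using assms(1) unfolding AE_unit_leb_iff
    by eventually_elim (use * assms(2-4) in auto)
  then have "{a<..<b} \<in> null_sets lborel"
    by (subst AE_iff_null_sets) auto
  then show False using \<open>a < b\<close> by (auto simp: null_sets_def)
qed

lemma measurable_mono_on_unit_leb: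
  fixes f :: "real \<Rightarrow> real"
  assumes "mono_on {0<..<1} f" shows "f \<in> borel_measurable unit_leb"
  using borel_measurable_mono_on_fnc[of "{0<..<1}" f] assms
  by (simp add: measurable_cong_sets[OF sets_restrict_space_cong[OF sets_lborel] refl])

section \<open>Square integrable functions on the unit interval\<close>

abbreviation sq_int :: "(real \<Rightarrow> real) \<Rightarrow> bool" where
  "sq_int \<equiv> square_integrable unit_leb"

text \<open>
  The bound \<open>\<bar>u * v\<bar> \<le> u\<^sup>2 + v\<^sup>2\<close> suffices for integrability, where the
  Cauchy--Schwarz inequality would also give the norm.
\<close>
lemma sq_int_mult_integrable:
  assumes "sq_int f" "sq_int g" shows "integrable unit_leb (\<lambda>x. f x * g x)"
proof (rule Bochner_Integration.integrable_bound)
  show "integrable unit_leb (\<lambda>x. (f x)\<^sup>2 + (g x)\<^sup>2)"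
    using assms by (auto simp: square_integrable_def)
  show "(\<lambda>x. f x * g x) \<in> borel_measurable unit_leb"
    using assms by (auto simp: square_integrable_def)
  have "norm (u * v) \<le> norm (u\<^sup>2 + v\<^sup>2)" for u v :: real
  proof -
    have "2 * (\<bar>u\<bar> * \<bar>v\<bar>) \<le> u\<^sup>2 + v\<^sup>2"
      using sum_squares_bound[of "\<bar>u\<bar>" "\<bar>v\<bar>"] by (simp add: power2_abs mult.assoc del: abs_mult_self_eq)
    moreover have "0 \<le> \<bar>u\<bar> * \<bar>v\<bar>" by simp
    ultimately show ?thesis unfolding real_norm_def abs_mult by linarith
  qed
  then show "AE x in unit_leb. norm (f x * g x) \<le> norm ((f x)\<^sup>2 + (g x)\<^sup>2)" by blast
qed

lemma sq_int_const [simp]: "sq_int (\<lambda>_. c)"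
  by (simp add: square_integrable_def)

lemma sq_int_integrable: "sq_int f \<Longrightarrow> integrable unit_leb f"
  using sq_int_mult_integrable[of f "\<lambda>_. 1"] by simp

lemma sq_int_measurable: "sq_int f \<Longrightarrow> f \<in> borel_measurable unit_leb"
  by (simp add: square_integrable_def)

lemma sq_int_add:
  assumes "sq_int f" "sq_int g" shows "sq_int (\<lambda>x. f x + g x)"
  using assms sq_int_mult_integrable[OF assms]
  by (auto simp: square_integrable_def power2_sum mult.assoc)

lemma sq_int_cmult: "sq_int f \<Longrightarrow> sq_int (\<lambda>x. c * f x)"
  by (auto simp: square_integrable_def power_mult_distrib)

lemma sq_int_diff:
  assumes "sq_int f" "sq_int g" shows "sq_int (\<lambda>x. f x - g x)"
  using sq_int_add[OF assms(1) sq_int_cmult[OF assms(2), of "-1"]] by simp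

lemma sq_int_if:
  assumes "sq_int f" "sq_int g" "A \<in> sets borel"
  shows "sq_int (\<lambda>x. if x \<in> A then f x else g x)"
proof -
  have [measurable]: "f \<in> borel_measurable unit_leb" "g \<in> borel_measurable unit_leb"
    using assms by (auto simp: square_integrable_def)
  have [measurable]: "Measurable.pred unit_leb (\<lambda>x. x \<in> A)"
    using assms(3) by (intro measurable_restrict_space1) simp
  show ?thesis unfolding square_integrable_def
  proof (intro conjI)
    show "(\<lambda>x. if x \<in> A then f x else g x) \<in> borel_measurable unit_leb" by measurable
    show "integrable unit_leb (\<lambda>x. (if x \<in> A then f x else g x)\<^sup>2)"
      by (rule Bochner_Integration.integrable_bound[where f="\<lambda>x. (f x)\<^sup>2 + (g x)\<^sup>2"])
        (use assms in \<open>auto simp: square_integrable_def\<close>)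
  qed
qed

lemma sq_int_sq_diff:
  assumes "sq_int f" "sq_int g"
  shows "(LINT x|unit_leb. (f x - g x)\<^sup>2) = (LINT x|unit_leb. (f x)\<^sup>2) - 2 * (LINT x|unit_leb. f x * g x) + (LINT x|unit_leb. (g x)\<^sup>2)"
proof -
  have "(LINT x|unit_leb. (f x - g x)\<^sup>2) = (LINT x|unit_leb. (f x)\<^sup>2 - 2 * (f x * g x) + (g x)\<^sup>2)"
    by (simp add: power2_diff algebra_simps)
  also have "\<dots> = (LINT x|unit_leb. (f x)\<^sup>2) - 2 * (LINT x|unit_leb. f x * g x) + (LINT x|unit_leb. (g x)\<^sup>2)"
    using assms sq_int_mult_integrable[OF assms]
    by (subst Bochner_Integration.integral_add) (auto simp: square_integrable_def)
  finally show ?thesis .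
qed

lemma sq_int_AE_zero:
  assumes "sq_int f" "(LINT x|unit_leb. (f x)\<^sup>2) \<le> 0" shows "AE x in unit_leb. f x = 0"
proof -
  have "(LINT x|unit_leb. (f x)\<^sup>2) = 0"
    using assms(2) by (intro antisym) auto
  then have "AE x in unit_leb. (f x)\<^sup>2 = 0"
    using assms(1) by (subst (asm) integral_nonneg_eq_0_iff_AE) (auto simp: square_integrable_def)
  then show ?thesis by simp
qed

section \<open>Primitives\<close>

text \<open>
  Integrating over the whole measure space against an indicator, rather than over an interval,
  makes linearity and almost-everywhere congruence direct consequences of the corresponding facts
  for the Bochner integral. The half-open cut-off makes increments integrals over \<open>{x..<y}\<close>.
\<close>
definition primitive :: "(real \<Rightarrow> real) \<Rightarrow> real \<Rightarrow> real" where
  "primitive h x = (LINT w|unit_leb. indicator {..<x} w * h w)"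

lemma measurable_indicator_mult_unit_leb:
  fixes h :: "real \<Rightarrow> real"
  assumes "h \<in> borel_measurable unit_leb" "A \<in> sets borel"
  shows "(\<lambda>w. indicator A w * h w) \<in> borel_measurable unit_leb"
  using assms by (intro borel_measurable_times measurable_unit_lebI[of "indicator A"]) auto

lemma integrable_indicator_unit_leb:
  assumes "integrable unit_leb h" "A \<in> sets borel"
  shows "integrable unit_leb (\<lambda>w. indicator A w * h w :: real)"
proof -
  have "(\<lambda>w. indicator A w :: real) \<in> borel_measurable unit_leb"
    using assms(2) by (intro measurable_unit_lebI) simp
  then show ?thesis
    by (intro Bochner_Integration.integrable_bound[OF assms(1)])
      (use assms in \<open>auto simp: indicator_def\<close>)
qed

lemma primitive_0 [simp]: "primitive h 0 = 0"
proof -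
  have "primitive h 0 = (LINT w|unit_leb. 0)"
    unfolding primitive_def by (rule Bochner_Integration.integral_cong) auto
  then show ?thesis by simp
qed

lemma primitive_1: "primitive h 1 = (LINT w|unit_leb. h w)"
  unfolding primitive_def by (rule Bochner_Integration.integral_cong) auto

lemma primitive_add:
  assumes "integrable unit_leb f" "integrable unit_leb g"
  shows "primitive (\<lambda>x. f x + g x) x = primitive f x + primitive g x"
  using assms unfolding primitive_def
  by (simp add: distrib_left integrable_indicator_unit_leb)

lemma primitive_diff:
  assumes "integrable unit_leb f" "integrable unit_leb g"
  shows "primitive (\<lambda>x. f x - g x) x = primitive f x - primitive g x"
  using assms unfolding primitive_def
  by (simp add: right_diff_distrib integrable_indicator_unit_leb)

lemma primitive_cmult: "primitive (\<lambda>x. c * f x) x = c * primitive f x"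
  unfolding primitive_def by (simp add: mult.left_commute)

lemma primitive_increment:
  assumes "integrable unit_leb h" "x \<le> y"
  shows "primitive h y - primitive h x = (LINT w|unit_leb. indicator {x..<y} w * h w)"
proof -
  have "primitive h y - primitive h x = (LINT w|unit_leb. indicator {..<y} w * h w - indicator {..<x} w * h w)"
    unfolding primitive_def using assms by (simp add: integrable_indicator_unit_leb)
  also have "\<dots> = (LINT w|unit_leb. indicator {x..<y} w * h w)"
    using assms(2) by (intro Bochner_Integration.integral_cong) (auto simp: indicator_def)
  finally show ?thesis .
qed

lemma primitive_cong_AE:
  assumes "AE w in unit_leb. f w = g w"
    "f \<in> borel_measurable unit_leb" "g \<in> borel_measurable unit_leb"
  shows "primitive f x = primitive g x"
  unfolding primitive_def
  by (rule integral_cong_AE) (use assms in \<open>auto intro!: measurable_indicator_mult_unit_leb\<close>)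

lemma primitive_const:
  assumes "0 \<le> x" "x \<le> 1" shows "primitive (\<lambda>_. c) x = c * x"
proof -
  have "primitive (\<lambda>_. c) x = (LINT w|lborel. indicator {0<..<1} w *\<^sub>R (indicator {..<x} w * c))"
    unfolding primitive_def by (rule integral_restrict_space) auto
  also have "\<dots> = (LINT w|lborel. c * indicator {0<..<x} w)"
    using assms by (intro Bochner_Integration.integral_cong) (auto simp: indicator_def)
  finally have "primitive (\<lambda>_. c) x = (LINT w|lborel. c * indicator {0<..<x} w)" .
  then show ?thesis using assms by simp
qed

lemma interval_integral_eq_primitive_diff:
  assumes "integrable unit_leb h" "0 \<le> x" "x \<le> y" "y \<le> 1"
  shows "(LBINT w=x..y. h w) = primitive h y - primitive h x"
proof -
  have "(LBINT w=x..y. h w) = (LINT w|lborel. indicator {x<..<y} w * h w)"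
    using assms by (simp add: interval_integral_Ioo set_lebesgue_integral_def)
  also have "\<dots> = (LINT w|unit_leb. indicator {x<..<y} w * h w)"
    using assms by (subst integral_restrict_space)
      (auto intro!: Bochner_Integration.integral_cong simp: indicator_def)
  also have "\<dots> = (LINT w|unit_leb. indicator {x..<y} w * h w)"
  proof (rule integral_cong_AE)
    show "AE w in unit_leb. indicator {x<..<y} w * h w = indicator {x..<y} w * h w"
      using AE_unit_leb_not_eq[of x] by (auto simp: indicator_def)
  qed (use assms in \<open>auto intro!: measurable_indicator_mult_unit_leb\<close>)
  finally show ?thesis using primitive_increment[OF assms(1,3)] by simp
qed

lemma primitive_increment_mono:
  assumes "integrable unit_leb f" "integrable unit_leb g" "x \<le> y"
    "\<And>w. w \<in> {0<..<1} \<Longrightarrow> x < w \<Longrightarrow> w < y \<Longrightarrow> f w \<le> g w"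
  shows "primitive f y - primitive f x \<le> primitive g y - primitive g x"
  unfolding primitive_increment[OF assms(1,3)] primitive_increment[OF assms(2,3)]
proof (rule integral_mono_AE)
  show "AE w in unit_leb. indicator {x..<y} w * f w \<le> indicator {x..<y} w * g w"
    using AE_unit_leb_not_eq[of x] AE_space[of unit_leb]
    by eventually_elim (use assms(4) in \<open>auto simp: indicator_def\<close>)
qed (use assms in \<open>auto intro: integrable_indicator_unit_leb\<close>)

lemma primitive_increment_cong:
  assumes "integrable unit_leb f" "integrable unit_leb g" "x \<le> y"
    "\<And>w. w \<in> {0<..<1} \<Longrightarrow> x < w \<Longrightarrow> w < y \<Longrightarrow> f w = g w"
  shows "primitive f y - primitive f x = primitive g y - primitive g x"
  using primitive_increment_mono[OF assms(1-3)] primitive_increment_mono[OF assms(2,1,3)] assms(4)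
  by (intro antisym) auto

text \<open>
  After extension by zero the primitive is an indefinite gauge integral, whose continuity is
  classical.
\<close>
lemma continuous_on_primitive:
  assumes "integrable unit_leb h"
  shows "continuous_on {0..1} (primitive h)"
proof -
  define h0 where "h0 w = indicator {0<..<1} w * h w" for w
  have "integrable lborel h0"
    using assms unfolding h0_def by (subst (asm) integrable_restrict_space) auto
  then have int: "set_integrable lborel {0..x} h0" for x
    unfolding set_integrable_def by (intro integrable_mult_indicator) auto
  have "continuous_on {0..1} (\<lambda>x. integral {0..x} h0)"
    by (intro indefinite_integral_continuous_1 set_borel_integral_eq_integral(1) int)
  moreover have "integral {0..x} h0 = primitive h x" if "x \<in> {0..1}" for x
  proof -
    have "integral {0..x} h0 = (LINT w|lborel. indicator {0..x} w * h0 w)"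
      using set_borel_integral_eq_integral(2)[OF int, of x] by (simp add: set_lebesgue_integral_def)
    also have "\<dots> = (LINT w|unit_leb. indicator {0..x} w * h w)"
      by (subst integral_restrict_space)
        (auto intro!: Bochner_Integration.integral_cong simp: h0_def indicator_def)
    also have "\<dots> = primitive h x" unfolding primitive_def
    proof (rule integral_cong_AE)
      show "AE w in unit_leb. indicator {0..x} w * h w = indicator {..<x} w * h w"
        using AE_unit_leb_not_eq[of x] AE_space[of unit_leb]
        by eventually_elim (auto simp: indicator_def)
    qed (use assms in \<open>auto intro!: measurable_indicator_mult_unit_leb\<close>)
    finally show ?thesis .
  qed
  ultimately show ?thesis by (subst (asm) continuous_on_cong[OF refl]) auto
qed

text \<open>
  The primitive of a nondecreasing function is convex: the slope \<open>g x\<close> separates the mean slopes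
  on the two sides of \<open>x\<close>. The chord is written as seen from its right end point, the form in which
  it enters the formula for the time of collapse.
\<close>
lemma primitive_chord:
  assumes "integrable unit_leb g" "mono_on {0<..<1} g" "0 \<le> a" "a < x" "x < b" "b \<le> 1"
  shows "primitive g x \<le> primitive g b + (x - b) / (b - a) * (primitive g b - primitive g a)"
proof -
  have c: "primitive (\<lambda>_. g x) y - primitive (\<lambda>_. g x) z = g x * (y - z)"
    if "y \<in> {0..1}" "z \<in> {0..1}" for y z
    using that by (simp add: primitive_const algebra_simps)
  have "primitive g x - primitive g a \<le> primitive (\<lambda>_. g x) x - primitive (\<lambda>_. g x) a"
    by (rule primitive_increment_mono) (use assms in \<open>auto intro!: mono_onD[OF assms(2)]\<close>)
  then have "primitive g x - primitive g a \<le> g x * (x - a)"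
    using c[of x a] assms by simp
  moreover have "primitive (\<lambda>_. g x) b - primitive (\<lambda>_. g x) x \<le> primitive g b - primitive g x"
    by (rule primitive_increment_mono) (use assms in \<open>auto intro!: mono_onD[OF assms(2)]\<close>)
  then have "g x * (b - x) \<le> primitive g b - primitive g x"
    using c[of b x] assms by simp
  ultimately have "(primitive g x - primitive g a) * (b - x) \<le> g x * (x - a) * (b - x)"
      "g x * (b - x) * (x - a) \<le> (primitive g b - primitive g x) * (x - a)"
    using assms by (auto intro!: mult_right_mono)
  then have "(b - a) * primitive g x \<le> (b - a) * primitive g b + (x - b) * (primitive g b - primitive g a)"
    by (simp add: algebra_simps)
  then show ?thesis using assms by (simp add: field_simps)
qed

section \<open>Pairing with nondecreasing functions\<close>

text \<open>
  An up-closed subset of the interval is, up to its left end point, a half-line \<open>{y<..}\<close>.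
\<close>
lemma LINT_up_set:
  assumes "integrable unit_leb u" "A \<subseteq> {0<..<1}"
    and up: "\<And>x y. x \<in> A \<Longrightarrow> x < y \<Longrightarrow> y < 1 \<Longrightarrow> y \<in> A" and "A \<in> sets borel"
  shows "\<exists>y\<in>{0..1}. (LINT x|unit_leb. indicator A x * u x) = primitive u 1 - primitive u y"
proof
  define y where "y = Inf (insert 1 A)"
  have bdd: "bdd_below (insert 1 A)" using assms(2) by (auto intro!: bdd_belowI[of _ 0])
  show "y \<in> {0..1}"
    using assms(2) bdd unfolding y_def by (auto intro!: cInf_greatest cInf_lower)
  have "w \<in> A \<longleftrightarrow> y < w" if "w \<in> {0<..<1}" "w \<noteq> y" for w
  proof
    assume "w \<in> A"
    then have "y \<le> w" using bdd unfolding y_def by (intro cInf_lower) auto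
    then show "y < w" using that by simp
  next
    assume "y < w"
    then obtain a where "a \<in> insert 1 A" "a < w"
      unfolding y_def by (subst (asm) cInf_less_iff[OF _ bdd]) auto
    then show "w \<in> A" using up that by auto
  qed
  note mem_iff = this
  have "AE w in unit_leb. indicator A w * u w = u w - indicator {..<y} w * u w"
    using AE_unit_leb_not_eq[of y] AE_space[of unit_leb]
    by eventually_elim (use mem_iff in \<open>auto simp: indicator_def\<close>)
  then have "(LINT x|unit_leb. indicator A x * u x) = (LINT x|unit_leb. u x - indicator {..<y} x * u x)"
    using assms by (intro integral_cong_AE)
      (auto intro!: measurable_indicator_mult_unit_leb borel_measurable_diff)
  also have "\<dots> = primitive u 1 - primitive u y"
    using assms(1) by (subst Bochner_Integration.integral_diff)
      (auto simp: primitive_1 integrable_indicator_unit_leb primitive_def[of u y])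
  finally show "(LINT x|unit_leb. indicator A x * u x) = primitive u 1 - primitive u y" .
qed

text \<open>
  The signed layer cake kernel: \<open>y\<close> is the integral of \<open>layer s y\<close> over all real \<open>s\<close>, with
  absolutely convergent integral for every sign of \<open>y\<close>. So unbounded functions need no truncation.
\<close>
definition layer :: "real \<Rightarrow> real \<Rightarrow> real" where
  "layer s y = (if s < y then 1 else 0) - (if s < 0 then 1 else 0)"

lemma layer_integral:
  "integrable lborel (\<lambda>s. layer s y)" "(LINT s|lborel. layer s y) = y"
  "(LINT s|lborel. \<bar>layer s y\<bar>) = \<bar>y\<bar>"
proof -
  have pos: "(\<lambda>s. layer s y) = indicator {0..<y}" "(\<lambda>s. \<bar>layer s y\<bar>) = indicator {0..<y}" if "0 \<le> y"
    using that by (auto simp: layer_def indicator_def fun_eq_iff)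
  have neg: "(\<lambda>s. layer s y) = (\<lambda>s. - indicator {y..<0} s)" "(\<lambda>s. \<bar>layer s y\<bar>) = indicator {y..<0}" if "\<not> 0 \<le> y"
    using that by (auto simp: layer_def indicator_def fun_eq_iff)
  show "integrable lborel (\<lambda>s. layer s y)"
    by (cases "0 \<le> y") (simp_all add: pos neg)
  show "(LINT s|lborel. layer s y) = y" "(LINT s|lborel. \<bar>layer s y\<bar>) = \<bar>y\<bar>"
    by (cases "0 \<le> y"; simp add: pos neg)+
qed

text \<open>
  Formally this is the integration by parts \<open>\<integral> u k = - \<integral> U dk\<close> with \<open>U\<close> the primitive of \<open>u\<close>, which
  vanishes at both ends of the interval. The layer cake formula makes it rigorous: every superlevel set
  of \<open>k\<close> is up-closed, so that it contributes \<open>U 1 - U y = - U y\<close> for some \<open>y\<close>.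
\<close>
lemma monotone_pairing_nonpos:
  assumes u: "sq_int u" and k: "sq_int k" and mono: "mono_on {0<..<1} k"
    and nonneg: "\<And>x. x \<in> {0..1} \<Longrightarrow> 0 \<le> primitive u x" and zero: "primitive u 1 = 0"
  shows "(LINT x|unit_leb. u x * k x) \<le> 0"
proof -
  interpret pair_sigma_finite unit_leb lborel ..
  note [measurable] = sq_int_measurable[OF u] sq_int_measurable[OF k]
  \<comment> \<open>Fubini applies because integrating the absolute value over \<open>s\<close> leaves the integrable
     function \<open>\<bar>u x * k x\<bar>\<close>.\<close>
  have "integrable (unit_leb \<Otimes>\<^sub>M lborel) (\<lambda>(x, s). u x * layer s (k x))"
  proof (rule Fubini_integrable)
    show "(\<lambda>(x, s). u x * layer s (k x)) \<in> borel_measurable (unit_leb \<Otimes>\<^sub>M lborel)"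
      unfolding layer_def by measurable
    have "integrable unit_leb (\<lambda>x. \<bar>u x * k x\<bar>)"
      using sq_int_mult_integrable[OF u k] by (rule integrable_abs)
    then show "integrable unit_leb (\<lambda>x. LINT s|lborel. norm (case (x, s) of (x, s) \<Rightarrow> u x * layer s (k x)))"
      by (simp add: abs_mult layer_integral)
    show "AE x in unit_leb. integrable lborel (\<lambda>s. case (x, s) of (x, s) \<Rightarrow> u x * layer s (k x))"
      by (simp add: layer_integral(1))
  qed
  note Fubini_integral[OF this]
  moreover have "(LINT s|lborel. u x * layer s (k x)) = u x * k x" for x
    by (simp add: layer_integral(2))
  ultimately have "(LINT x|unit_leb. u x * k x) = (LINT s|lborel. (LINT x|unit_leb. u x * layer s (k x)))"
    by (simp only: layer_integral(2))
  also have "\<dots> = (LINT s|lborel. - (- (LINT x|unit_leb. u x * layer s (k x))))" by simp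
  also have "\<dots> = - (LINT s|lborel. - (LINT x|unit_leb. u x * layer s (k x)))"
    by (rule integral_minus)
  also have "\<dots> \<le> 0"
  proof -
    have "(LINT x|unit_leb. u x * layer s (k x)) \<le> 0" for s
    proof -
      define A where "A = {x \<in> {0<..<1}. s < k x}"
      have "{x \<in> space unit_leb. s < k x} \<in> sets unit_leb" by measurable
      then have A: "A \<in> sets borel"
        unfolding A_def by (auto simp: sets_restrict_space_iff)
      obtain y where y: "y \<in> {0..1}" "(LINT x|unit_leb. indicator A x * u x) = primitive u 1 - primitive u y"
        using LINT_up_set[OF sq_int_integrable[OF u] _ _ A] mono_onD[OF mono]
        unfolding A_def by (fastforce intro: less_le_trans)
      have "(LINT x|unit_leb. u x * layer s (k x)) = (LINT x|unit_leb. indicator A x * u x - (if s < 0 then 1 else 0) * u x)"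
        by (intro Bochner_Integration.integral_cong) (auto simp: layer_def A_def)
      also have "\<dots> = (LINT x|unit_leb. indicator A x * u x) - (if s < 0 then 1 else 0) * primitive u 1"
        using sq_int_integrable[OF u] A unfolding primitive_1
        by (subst Bochner_Integration.integral_diff) (auto intro: integrable_indicator_unit_leb)
      finally show ?thesis using y nonneg[of y] zero by simp
    qed
    then have "0 \<le> (LINT s|lborel. - (LINT x|unit_leb. u x * layer s (k x)))"
      by (intro Bochner_Integration.integral_nonneg) simp
    then show ?thesis by linarith
  qed
  finally show ?thesis .
qed

section \<open>Functions determined by their primitives\<close>

text \<open>
  The difference \<open>f - g\<close> has primitive zero, so its pairings with \<open>f\<close> and with \<open>g\<close> are nonpositive for
  either sign of the difference. They add up to the square of its norm.
\<close>
lemma AE_eq_if_primitive_eq_mono: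
  assumes f: "sq_int f" "mono_on {0<..<1} f" and g: "sq_int g" "mono_on {0<..<1} g"
    and eq: "\<And>x. x \<in> {0..1} \<Longrightarrow> primitive f x = primitive g x"
  shows "AE x in unit_leb. f x = g x"
proof -
  note int = sq_int_integrable[OF f(1)] sq_int_integrable[OF g(1)]
  have "(LINT x|unit_leb. (f x - g x) * f x) \<le> 0"
    by (rule monotone_pairing_nonpos) (use f g eq int in \<open>auto simp: primitive_diff sq_int_diff\<close>)
  moreover have "(LINT x|unit_leb. (g x - f x) * g x) \<le> 0"
    by (rule monotone_pairing_nonpos) (use f g eq int in \<open>auto simp: primitive_diff sq_int_diff\<close>)
  moreover have "(LINT x|unit_leb. (f x - g x)\<^sup>2) = (LINT x|unit_leb. (f x - g x) * f x) + (LINT x|unit_leb. (g x - f x) * g x)"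
    using f g by (subst Bochner_Integration.integral_add[symmetric])
      (auto intro!: sq_int_mult_integrable sq_int_diff Bochner_Integration.integral_cong simp: power2_eq_square algebra_simps)
  ultimately have "AE x in unit_leb. f x - g x = 0"
    by (intro sq_int_AE_zero sq_int_diff f g) simp
  then show ?thesis by simp
qed

text \<open>
  The sets over which \<open>f\<close> integrates to zero form a Dynkin system that contains the half-lines.
\<close>
lemma AE_zero_if_primitive_zero:
  assumes int: "integrable unit_leb f" and zero: "\<And>x. x \<in> {0..1} \<Longrightarrow> primitive f x = 0"
  shows "AE x in unit_leb. f x = 0"
proof (rule unit_leb.density_zero[OF int])
  have tot: "(LINT x|unit_leb. f x) = 0" using zero[of 1] by (simp add: primitive_1)
  have base: "(LINT x|unit_leb. indicator {..<y} x * f x) = 0" for y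
  proof -
    have "(LINT x|unit_leb. indicator {..<y} x * f x) = (LINT x|unit_leb. indicator {..<max 0 (min 1 y)} x * f x)"
      by (intro Bochner_Integration.integral_cong) (auto simp: indicator_def)
    then show ?thesis using zero[of "max 0 (min 1 y)"] by (auto simp: primitive_def)
  qed
  define f0 where "f0 w = indicator {0<..<1} w * f w" for w
  have f0: "set_integrable lborel A f0" if "A \<in> sets borel" for A
  proof -
    have "integrable lborel f0"
      using int unfolding f0_def by (subst (asm) integrable_restrict_space) auto
    then show ?thesis
      unfolding set_integrable_def using that by (intro integrable_mult_indicator) auto
  qed
  have eq: "(LINT x|unit_leb. indicator A x * f x) = (LINT x:A|lborel. f0 x)" for A
    unfolding set_lebesgue_integral_def
    by (subst integral_restrict_space)
      (auto intro!: Bochner_Integration.integral_cong simp: f0_def indicator_def)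
  have borel: "sigma_sets UNIV (range lessThan) = sets (borel :: real measure)"
    by (simp add: borel_Iio)
  have all: "(LINT x|unit_leb. indicator A x * f x) = 0" if "A \<in> sets borel" for A
  proof -
    have "Int_stable (range lessThan :: real set set)"
      unfolding Int_stable_def
    proof (intro ballI)
      fix A B :: "real set" assume "A \<in> range lessThan" "B \<in> range lessThan"
      then obtain a b where "A = {..<a}" "B = {..<b}" by auto
      then have "A \<inter> B = {..<min a b}" by auto
      then show "A \<inter> B \<in> range lessThan" by simp
    qed
    moreover have "range lessThan \<subseteq> Pow (UNIV :: real set)" by simp
    moreover have "A \<in> sigma_sets UNIV (range lessThan)" using that borel by simp
    ultimately show ?thesis
    proof (induction A rule: sigma_sets_induct_disjoint)
      case (basic A) then show ?case using base by auto
    next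
      case empty show ?case by simp
    next
      case (compl A)
      then have A: "A \<in> sets borel" by (simp add: borel)
      have "(LINT x|unit_leb. indicator (UNIV - A) x * f x) = (LINT x|unit_leb. f x - indicator A x * f x)"
        by (intro Bochner_Integration.integral_cong) (auto simp: indicator_def)
      also have "\<dots> = 0"
        using compl tot A int by (subst Bochner_Integration.integral_diff) (auto intro: integrable_indicator_unit_leb)
      finally show ?case .
    next
      case (union A)
      then have A: "A i \<in> sets borel" for i by (auto simp: borel)
      have "(LINT x:(\<Union>i. A i)|lborel. f0 x) = (\<Sum>i. (LINT x:A i|lborel. f0 x))"
        by (rule lebesgue_integral_countable_add)
          (use A union(1) in \<open>auto simp: disjoint_family_on_def intro!: f0\<close>)
      then show ?case using union(3) by (simp add: eq)
    qed
  qed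
  fix A assume "A \<in> sets unit_leb"
  then have "A \<in> sets borel" by (auto simp: sets_restrict_space_iff)
  then show "set_lebesgue_integral unit_leb A f = 0"
    using all by (simp add: set_lebesgue_integral_def)
qed

section \<open>Components of positivity\<close>

text \<open>
  The connected component of \<open>{D > 0}\<close> that contains \<open>x\<close>, found from the nearest points on
  either side at which \<open>D\<close> is nonpositive.
\<close>
lemma positive_component:
  fixes D :: "real \<Rightarrow> real"
  assumes cont: "continuous_on {a..b} D" and "D a \<le> 0" "D b \<le> 0" "x \<in> {a..b}" "0 < D x"
  obtains p q where "a \<le> p" "p < x" "x < q" "q \<le> b" "D p = 0" "D q = 0"
    "\<And>y. p < y \<Longrightarrow> y < q \<Longrightarrow> 0 < D y"
proof -
  define L where "L = {y \<in> {a..x}. D y \<in> {..0}}"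
  define R where "R = {y \<in> {x..b}. D y \<in> {..0}}"
  have cL: "closed L" and cR: "closed R"
    unfolding L_def R_def atMost_iff using assms(4)
    by (intro continuous_on_closed_Collect_le continuous_on_subset[OF cont]; simp)+
  have "a \<in> L" "b \<in> R" using assms by (auto simp: L_def R_def)
  have bL: "bdd_above L" and bR: "bdd_below R" by (auto simp: L_def R_def)
  define p q where "p = Sup L" and "q = Inf R"
  have p: "p \<in> L" unfolding p_def using cL \<open>a \<in> L\<close> bL by (intro closed_contains_Sup) auto
  have q: "q \<in> R" unfolding q_def using cR \<open>b \<in> R\<close> bR by (intro closed_contains_Inf) auto
  have lt: "p < x" "x < q" using p q \<open>0 < D x\<close> unfolding L_def R_def by (auto simp: less_le)
  have pos: "0 < D y" if "p < y" "y < q" for y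
  proof (rule ccontr)
    assume "\<not> 0 < D y"
    then have "y \<in> L \<or> y \<in> R" using that p q by (auto simp: L_def R_def)
    then have "y \<le> p \<or> q \<le> y" using bL bR unfolding p_def q_def by (auto intro: cSup_upper cInf_lower)
    then show False using that by auto
  qed
  have "D p = 0"
  proof (rule ccontr)
    assume "D p \<noteq> 0"
    then have "D p \<le> 0" "D p \<noteq> 0" using p by (auto simp: L_def)
    moreover have "continuous_on {p..x} D" using p assms by (intro continuous_on_subset[OF cont]) (auto simp: L_def)
    ultimately obtain z where "p \<le> z" "z \<le> x" "D z = 0"
      using IVT'[of D p 0 x] lt \<open>0 < D x\<close> by auto
    then show False using pos[of z] lt \<open>D p \<noteq> 0\<close> by (cases "z = p") auto
  qed
  moreover have "D q = 0"
  proof (rule ccontr)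
    assume "D q \<noteq> 0"
    then have "D q \<le> 0" "D q \<noteq> 0" using q by (auto simp: R_def)
    moreover have "continuous_on {x..q} D" using q assms by (intro continuous_on_subset[OF cont]) (auto simp: R_def)
    ultimately obtain z where "x \<le> z" "z \<le> q" "D z = 0"
      using IVT2'[of D q 0 x] lt \<open>0 < D x\<close> by auto
    then show False using pos[of z] lt \<open>D q \<noteq> 0\<close> by (cases "z = q") auto
  qed
  ultimately show thesis using that[of p q] p q lt pos by (auto simp: L_def R_def)
qed

section \<open>Right-continuous representatives and optimal maps\<close>

text \<open>
  The right-limit function differs from \<open>k\<close> only at the countably many jumps of \<open>k\<close>.
\<close>
lemma right_continuous_modification:
  assumes k: "mono_on {0<..<1} k"
  obtains g where "mono_on {0<..<1} g" "right_continuous_01 g" "\<And>x. x \<notin> {0<..<1} \<Longrightarrow> g x = 0"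
    "AE x in unit_leb. g x = k x"
proof -
  define g where "g x = (if x \<in> {0<..<1} then Inf (k ` {x<..<1}) else 0)" for x :: real
  have bdd: "bdd_below (k ` {x<..<1})" if "x \<in> {0<..<1}" for x
    using that by (auto intro!: bdd_belowI[of _ "k x"] mono_onD[OF k])
  have ne: "k ` {x<..<1} \<noteq> {}" if "x \<in> {0<..<1}" for x :: real
    using that by auto
  have le: "g x \<le> k y" if "0 < x" "x < y" "y < 1" for x y
    using that bdd[of x] unfolding g_def by (auto intro!: cInf_lower)
  have ge: "k x \<le> g x" if "0 < x" "x < 1" for x
    using that ne[of x] unfolding g_def by (auto intro!: cInf_greatest mono_onD[OF k])
  have mono: "mono_on {0<..<1} g"
  proof (rule mono_onI)
    fix x y :: real assume "x \<in> {0<..<1}" "y \<in> {0<..<1}" "x \<le> y"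
    then show "g x \<le> g y" using le[of x y] ge[of y] by (cases "x = y") auto
  qed
  moreover have "right_continuous_01 g"
    unfolding right_continuous_01_def
  proof
    fix x :: real assume x: "x \<in> {0<..<1}"
    have "(g \<longlongrightarrow> g x) (at_right x)"
    proof (rule order_tendstoI)
      fix a assume "a < g x"
      then show "\<forall>\<^sub>F y in at_right x. a < g y"
        using x mono_onD[OF mono, of x] unfolding eventually_at_right_field
        by (intro exI[of _ 1]) (auto intro: less_le_trans)
    next
      fix a assume "g x < a"
      then obtain y where "x < y" "y < 1" "k y < a"
        using x bdd[of x] ne[of x] unfolding g_def by (auto simp: cInf_less_iff)
      then show "\<forall>\<^sub>F y in at_right x. g y < a"
        using x le unfolding eventually_at_right_field
        by (intro exI[of _ y]) (smt (verit, best) greaterThanLessThan_iff)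
    qed
    then show "continuous (at_right x) g" by (simp add: continuous_within)
  qed
  moreover have "AE x in unit_leb. g x = k x"
    using AE_unit_leb_countable[OF mono_on_ctble_discont_open[OF open_greaterThanLessThan k]] AE_space[of unit_leb]
  proof eventually_elim
    case (elim x)
    then have x: "0 < x" "x < 1" and "isCont k x" by auto
    have "g x \<le> k x"
    proof (rule tendsto_lowerbound)
      show "(k \<longlongrightarrow> k x) (at_right x)" using \<open>isCont k x\<close>
        by (meson continuous_at_imp_continuous_at_within continuous_within)
      show "\<forall>\<^sub>F y in at_right x. g x \<le> k y"
        unfolding eventually_at_right_field using x le by (intro exI[of _ 1]) auto
    qed simp
    then show ?case using ge x by (auto intro: antisym)
  qed
  moreover have "g x = 0" if "x \<notin> {0<..<1}" for x using that by (auto simp: g_def)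
  ultimately show thesis using that by blast
qed

lemma right_continuous_AE_eq:
  assumes "right_continuous_01 f" "right_continuous_01 g" "AE x in unit_leb. f x = g x" "x \<in> {0<..<1}"
  shows "f x = g x"
proof (rule ccontr)
  assume ne: "f x \<noteq> g x"
  have "((\<lambda>y. f y - g y) \<longlongrightarrow> f x - g x) (at_right x)"
    using assms by (intro tendsto_diff) (auto simp: right_continuous_01_def continuous_within)
  then have "\<forall>\<^sub>F y in at_right x. f y - g y \<noteq> 0"
    by (rule tendsto_imp_eventually_ne) (use ne in auto)
  then obtain b where b: "x < b" "\<And>y. x < y \<Longrightarrow> y < b \<Longrightarrow> f y \<noteq> g y"
    unfolding eventually_at_right_field by auto
  then show False
    using AE_unit_leb_ex_between[OF assms(3), of x "min b 1"] assms(4) by auto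
qed

text \<open>
  If \<open>f x < g x\<close>, then right continuity keeps \<open>f\<close> below \<open>g x\<close> on some \<open>{0<..<y}\<close> with \<open>y > x\<close>. The
  common image measure then gives the half-line \<open>{..<g x}\<close> mass at least \<open>y\<close> when seen through \<open>f\<close> and at
  most \<open>x\<close> when seen through \<open>g\<close>.
\<close>
lemma optimal_map_unique:
  assumes f: "mono_on {0<..<1} f" "right_continuous_01 f"
    and g: "mono_on {0<..<1} g" "right_continuous_01 g"
    and eq: "distr unit_leb borel f = distr unit_leb borel g" and x: "x \<in> {0<..<1}"
  shows "f x = g x"
proof -
  have not_less: "\<not> f x < g x"
    if f: "mono_on {0<..<1} f" "right_continuous_01 f" and g: "mono_on {0<..<1} g"
    and eq: "distr unit_leb borel f = distr unit_leb borel g" for f g :: "real \<Rightarrow> real"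
  proof
    assume less: "f x < g x"
    have "(f \<longlongrightarrow> f x) (at_right x)" using f x by (auto simp: right_continuous_01_def continuous_within)
    from order_tendstoD(2)[OF this less] obtain b where b: "x < b" "\<And>y. x < y \<Longrightarrow> y < b \<Longrightarrow> f y < g x"
      unfolding eventually_at_right_field by auto
    define y where "y = (x + min b 1) / 2"
    have y: "x < y" "y < b" "y < 1" using b x by (auto simp: y_def)
    have fy: "f y < g x" using b y by simp
    note [measurable] = measurable_mono_on_unit_leb[OF f(1)] measurable_mono_on_unit_leb[OF g]
    have eqm: "measure unit_leb {w \<in> space unit_leb. f w < g x} = measure unit_leb {w \<in> space unit_leb. g w < g x}"
      using arg_cong[OF eq, of "\<lambda>M. measure M {..<g x}"]
      by (simp add: measure_distr vimage_def Int_def conj_commute)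
    have meas: "measure unit_leb {0<..<z} = z" if "0 < z" "z \<le> 1" for z
      using that by (subst measure_restrict_space) auto
    have "measure unit_leb {w \<in> space unit_leb. g w < g x} \<le> measure unit_leb {0<..<x}"
    proof (rule unit_leb.finite_measure_mono)
      show "{w \<in> space unit_leb. g w < g x} \<subseteq> {0<..<x}"
        using x mono_onD[OF g, of x] by (auto simp: not_less[symmetric]) (metis greaterThanLessThan_iff leD linorder_not_le)
    qed (use x in \<open>auto simp: sets_restrict_space_iff\<close>)
    moreover have "measure unit_leb {0<..<y} \<le> measure unit_leb {w \<in> space unit_leb. f w < g x}"
    proof (rule unit_leb.finite_measure_mono)
      show "{0<..<y} \<subseteq> {w \<in> space unit_leb. f w < g x}"
        using y fy mono_onD[OF f(1), of _ y] x by fastforce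
    qed measurable
    ultimately show False using eqm meas[of x] meas[of y] x y by auto
  qed
  show ?thesis using not_less[OF f g(1) eq] not_less[OF g f(1) eq[symmetric]] by simp
qed

section \<open>Projection onto the cone of nondecreasing functions\<close>

lemma mono_coneD:
  assumes "g \<in> mono_cone" shows "sq_int g" "mono_on {0<..<1} g"
  using assms by (auto simp: mono_cone_def)

lemma mono_cone_add: "f \<in> mono_cone \<Longrightarrow> g \<in> mono_cone \<Longrightarrow> (\<lambda>x. f x + g x) \<in> mono_cone"
  by (auto simp: mono_cone_def intro!: sq_int_add mono_onI add_mono dest: mono_onD)

lemma mono_cone_cmult: "f \<in> mono_cone \<Longrightarrow> 0 \<le> c \<Longrightarrow> (\<lambda>x. c * f x) \<in> mono_cone"
  by (auto simp: mono_cone_def intro!: sq_int_cmult mono_onI mult_left_mono dest: mono_onD)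

lemma mono_cone_const: "(\<lambda>_. c) \<in> mono_cone"
  by (auto simp: mono_cone_def intro!: mono_onI)

abbreviation sq_dist :: "(real \<Rightarrow> real) \<Rightarrow> (real \<Rightarrow> real) \<Rightarrow> real" where
  "sq_dist f g \<equiv> (LINT x|unit_leb. (f x - g x)\<^sup>2)"

text \<open>
  The parallelogram identity, with the midpoint of \<open>g\<close> and \<open>h\<close> in the convex cone. It makes
  minimising sequences Cauchy and minimisers unique.
\<close>
lemma near_minimizers_close:
  assumes f: "sq_int f" and g: "g \<in> mono_cone" and h: "h \<in> mono_cone"
    and low: "\<And>k. k \<in> mono_cone \<Longrightarrow> d \<le> sq_dist f k"
  shows "sq_dist g h \<le> 2 * (sq_dist f g - d) + 2 * (sq_dist f h - d)"
proof -
  define m where "m = (\<lambda>x. (1/2) * (g x + h x))"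
  have m: "m \<in> mono_cone" unfolding m_def by (intro mono_cone_cmult mono_cone_add g h) simp
  have sq: "integrable unit_leb (\<lambda>x. (f x - k x)\<^sup>2)" if "k \<in> mono_cone" for k
    using sq_int_diff[OF f mono_coneD(1)[OF that]] by (simp add: square_integrable_def)
  have "(g x - h x)\<^sup>2 = 2 * (f x - g x)\<^sup>2 + 2 * (f x - h x)\<^sup>2 - 4 * (f x - m x)\<^sup>2" for x
    unfolding m_def by (simp add: power2_eq_square field_simps)
  then have "sq_dist g h = 2 * sq_dist f g + 2 * sq_dist f h - 4 * sq_dist f m"
    using sq[OF g] sq[OF h] sq[OF m] by simp
  then show ?thesis using low[OF m] by (simp add: algebra_simps)
qed

text \<open>
  The geometric decay makes the \<open>L\<^sup>1\<close> norms of the increments summable, so that the increments are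
  summable at almost every point.
\<close>
lemma AE_convergent_if_L2_fast:
  assumes g: "\<And>n. sq_int (g n)" and fast: "\<And>n. sq_dist (g n) (g (Suc n)) \<le> (1/4) ^ n"
  shows "AE x in unit_leb. convergent (\<lambda>n. g n x)"
proof -
  define d where "d n x = \<bar>g (Suc n) x - g n x\<bar>" for n x
  have sqd: "sq_int (\<lambda>x. g n x - g (Suc n) x)" for n
    by (intro sq_int_diff g)
  have dm[measurable]: "d n \<in> borel_measurable unit_leb" for n
    unfolding d_def using sq_int_measurable[OF g] by measurable
  have di: "integrable unit_leb (d n)" for n
    unfolding d_def by (intro integrable_abs sq_int_integrable sq_int_diff g)
  have dle: "(LINT x|unit_leb. d n x) \<le> (1/2) ^ n" for n
  proof -
    \<comment> \<open>Young's inequality with weight \<open>2 ^ n\<close> balances both terms at the order \<open>(1/2) ^ n\<close>.\<close>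
    have "d n x \<le> (1/2) * ((1/2) ^ n + 2 ^ n * (g n x - g (Suc n) x)\<^sup>2)" for x
    proof -
      define e where "e = (2::real) ^ n"
      have e: "0 < e" "(1/2) ^ n = 1 / e" by (auto simp: e_def power_one_over)
      have "0 \<le> (e * d n x - 1)\<^sup>2 / e" using e by simp
      also have "(e * d n x - 1)\<^sup>2 / e = e * (d n x)\<^sup>2 - 2 * d n x + 1 / e"
        using e by (simp add: power2_eq_square field_simps)
      also have "(d n x)\<^sup>2 = (g n x - g (Suc n) x)\<^sup>2"
        by (simp add: d_def power2_commute)
      finally show ?thesis unfolding e(2) e_def[symmetric] by simp
    qed
    then have "(LINT x|unit_leb. d n x) \<le> (LINT x|unit_leb. (1/2) * ((1/2) ^ n + 2 ^ n * (g n x - g (Suc n) x)\<^sup>2))"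
      using di sqd by (intro integral_mono) (auto simp: square_integrable_def)
    also have "\<dots> = (1/2) * ((1/2) ^ n + 2 ^ n * sq_dist (g n) (g (Suc n)))"
      using sqd by (simp add: square_integrable_def unit_leb.prob_space[simplified])
    also have "\<dots> \<le> (1/2) * ((1/2) ^ n + 2 ^ n * (1/4) ^ n)"
      using fast by (intro mult_left_mono add_left_mono) auto
    also have "\<dots> = (1/2) ^ n" by (simp add: power_mult_distrib[symmetric])
    finally show ?thesis .
  qed
  have "(\<integral>\<^sup>+ x. (\<Sum>n. ennreal (d n x)) \<partial>unit_leb) = (\<Sum>n. \<integral>\<^sup>+ x. ennreal (d n x) \<partial>unit_leb)"
    by (rule nn_integral_suminf) measurable
  also have "\<dots> = (\<Sum>n. ennreal (LINT x|unit_leb. d n x))"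
    using di by (subst nn_integral_eq_integral) (auto simp: d_def)
  also have "\<dots> \<le> (\<Sum>n. ennreal ((1/2) ^ n))"
    using dle by (intro suminf_le ennreal_leI) auto
  also have "\<dots> = ennreal (\<Sum>n. (1/2) ^ n)"
    by (rule suminf_ennreal2) (auto intro: summable_geometric)
  finally have "(\<integral>\<^sup>+ x. (\<Sum>n. ennreal (d n x)) \<partial>unit_leb) \<noteq> \<infinity>"
    by (auto simp: top_unique)
  then have "AE x in unit_leb. (\<Sum>n. ennreal (d n x)) \<noteq> \<infinity>"
    by (intro nn_integral_PInf_AE) auto
  then show ?thesis
  proof eventually_elim
    case (elim x)
    then have "summable (\<lambda>n. d n x)"
      by (intro summable_suminf_not_top) (auto simp: d_def)
    then have "summable (\<lambda>n. g (Suc n) x - g n x)"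
      unfolding d_def by (rule summable_rabs_cancel)
    then have "convergent (\<lambda>n. (\<Sum>i<n. g (Suc i) x - g i x))"
      by (simp add: summable_iff_convergent)
    then have "convergent (\<lambda>n. g n x - g 0 x)"
      by (simp only: sum_lessThan_telescope[of "\<lambda>i. g i x"])
    then show ?case by (simp add: convergent_diff_const_right_iff)
  qed
qed

text \<open>
  The limit at the points of convergence is monotone there; taking suprema of its values to the left
  extends it to a monotone function on the whole interval.
\<close>
lemma monotone_AE_limit:
  fixes g :: "nat \<Rightarrow> real \<Rightarrow> real"
  assumes mono: "\<And>n. mono_on {0<..<1} (g n)" and conv: "AE x in unit_leb. convergent (\<lambda>n. g n x)"
  obtains l where "mono_on {0<..<1} l" "AE x in unit_leb. (\<lambda>n. g n x) \<longlonglongrightarrow> l x"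
proof -
  define C where "C x = {y. 0 < y \<and> y \<le> x \<and> convergent (\<lambda>n. g n y)}" for x
  define L where "L y = lim (\<lambda>n. g n y)" for y :: real
  have L: "(\<lambda>n. g n y) \<longlonglongrightarrow> L y" if "convergent (\<lambda>n. g n y)" for y
    using that by (simp add: L_def convergent_LIMSEQ_iff)
  have L_mono: "L y \<le> L z" if "convergent (\<lambda>n. g n y)" "convergent (\<lambda>n. g n z)" "0 < y" "y \<le> z" "z < 1" for y z
    using that by (intro LIMSEQ_le[OF L L]) (auto intro!: mono_onD[OF mono])
  define l where "l x = Sup (L ` C x)" for x
  have ne: "C x \<noteq> {}" if "x \<in> {0<..<1}" for x
    using AE_unit_leb_ex_between[OF conv, of 0 x] that by (fastforce simp: C_def)
  have bdd: "bdd_above (L ` C x)" if x: "x \<in> {0<..<1}" for x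
  proof -
    obtain z where "x < z" "z < 1" "convergent (\<lambda>n. g n z)"
      using AE_unit_leb_ex_between[OF conv, of x 1] x by auto
    then show ?thesis by (intro bdd_aboveI[of _ "L z"]) (auto simp: C_def intro!: L_mono)
  qed
  have "mono_on {0<..<1} l"
    unfolding l_def by (intro mono_onI cSup_subset_mono image_mono) (use ne bdd in \<open>auto simp: C_def\<close>)
  moreover have "AE x in unit_leb. (\<lambda>n. g n x) \<longlonglongrightarrow> l x"
    using conv AE_space[of unit_leb]
  proof eventually_elim
    case (elim x)
    then have "l x = L x"
      unfolding l_def by (intro cSup_eq_maximum) (auto simp: C_def intro!: L_mono)
    then show ?case using L elim by simp
  qed
  ultimately show thesis using that by blast
qed

text \<open>
  Fatou's lemma.
\<close>
lemma sq_dist_AE_limit_le: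
  assumes f: "sq_int f" and g: "\<And>n. sq_int (g n)" and l: "l \<in> borel_measurable unit_leb"
    and lim: "AE x in unit_leb. (\<lambda>n. g n x) \<longlonglongrightarrow> l x"
    and d: "(\<lambda>n. sq_dist f (g n)) \<longlonglongrightarrow> d"
  shows "sq_int l" "sq_dist f l \<le> d"
proof -
  note [measurable] = sq_int_measurable[OF f] sq_int_measurable[OF g] l
  have "0 \<le> d" by (rule LIMSEQ_le_const[OF d]) auto
  have "(\<integral>\<^sup>+ x. ennreal ((f x - l x)\<^sup>2) \<partial>unit_leb) = (\<integral>\<^sup>+ x. liminf (\<lambda>n. ennreal ((f x - g n x)\<^sup>2)) \<partial>unit_leb)"
  proof (rule nn_integral_cong_AE)
    show "AE x in unit_leb. ennreal ((f x - l x)\<^sup>2) = liminf (\<lambda>n. ennreal ((f x - g n x)\<^sup>2))"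
      using lim by eventually_elim
        (rule lim_imp_Liminf[symmetric], simp, intro tendsto_ennrealI tendsto_intros)
  qed
  also have "\<dots> \<le> liminf (\<lambda>n. \<integral>\<^sup>+ x. ennreal ((f x - g n x)\<^sup>2) \<partial>unit_leb)"
    by (rule nn_integral_liminf) measurable
  also have "\<dots> = liminf (\<lambda>n. ennreal (sq_dist f (g n)))"
    using sq_int_diff[OF f g] by (subst nn_integral_eq_integral) (auto simp: square_integrable_def)
  also have "\<dots> = ennreal d"
    using d by (intro lim_imp_Liminf tendsto_ennrealI) auto
  finally have le: "(\<integral>\<^sup>+ x. ennreal ((f x - l x)\<^sup>2) \<partial>unit_leb) \<le> ennreal d" .
  then have "integrable unit_leb (\<lambda>x. (f x - l x)\<^sup>2)"
    by (intro integrableI_nonneg) (auto simp: top_unique less_top[symmetric])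
  then have int: "sq_int (\<lambda>x. f x - l x)" by (simp add: square_integrable_def)
  show "sq_int l" using sq_int_diff[OF f int] by simp
  have "ennreal (sq_dist f l) \<le> ennreal d"
    using le int by (subst (asm) nn_integral_eq_integral) (auto simp: square_integrable_def)
  then show "sq_dist f l \<le> d" using \<open>0 \<le> d\<close> by simp
qed

text \<open>
  A minimising sequence whose \<open>n\<close>-th excess is below \<open>(1/4) ^ n / 4\<close> has \<open>L\<^sup>2\<close> increments small enough to
  converge almost everywhere. The limit is monotone, and Fatou's lemma makes it a minimiser.
\<close>
lemma proj_mono_exists:
  assumes f: "sq_int f"
  shows "\<exists>g. g \<in> mono_cone \<and> right_continuous_01 g \<and> (\<forall>x. x \<notin> {0<..<1} \<longrightarrow> g x = 0) \<and>
     (\<forall>h\<in>mono_cone. sq_dist f g \<le> sq_dist f h)"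
proof -
  define d where "d = Inf (sq_dist f ` mono_cone)"
  have ne: "sq_dist f ` mono_cone \<noteq> {}" using mono_cone_const by blast
  have bdd: "bdd_below (sq_dist f ` mono_cone)" by (intro bdd_belowI[of _ 0]) auto
  have low: "d \<le> sq_dist f k" if "k \<in> mono_cone" for k
    unfolding d_def using that bdd by (intro cInf_lower) auto
  have "\<exists>k\<in>mono_cone. sq_dist f k < d + (1/4) ^ n / 4" for n
  proof -
    have "Inf (sq_dist f ` mono_cone) < d + (1/4) ^ n / 4" by (simp add: d_def)
    then show ?thesis using cInf_less_iff[OF ne bdd] by auto
  qed
  then obtain g where g: "\<And>n. g n \<in> mono_cone" "\<And>n. sq_dist f (g n) < d + (1/4) ^ n / 4"
    by metis
  have e: "a \<le> (1/4) ^ n" if "a \<le> 2 * (b - d) + 2 * (c - d)" "b < d + (1/4) ^ n / 4" "c < d + (1/4) ^ Suc n / 4"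
    for a b c :: real and n
  proof -
    have "0 \<le> (1/4 :: real) ^ n" "(1/4 :: real) ^ Suc n = (1/4) * (1/4) ^ n" by simp_all
    with that show ?thesis by (simp only: right_diff_distrib)
  qed
  have "sq_dist (g n) (g (Suc n)) \<le> (1/4) ^ n" for n
    using near_minimizers_close[OF f g(1) g(1) low, of n "Suc n"] e[OF _ g(2)[of n] g(2)[of "Suc n"]] by simp
  note conv = AE_convergent_if_L2_fast[of g, OF mono_coneD(1)[OF g(1)] this]
  obtain l where l: "mono_on {0<..<1} l" "AE x in unit_leb. (\<lambda>n. g n x) \<longlonglongrightarrow> l x"
    by (rule monotone_AE_limit[of g, OF mono_coneD(2)[OF g(1)] conv])
  obtain k where k: "mono_on {0<..<1} k" "right_continuous_01 k" "\<And>x. x \<notin> {0<..<1} \<Longrightarrow> k x = 0"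
    "AE x in unit_leb. k x = l x"
    using right_continuous_modification[OF l(1)] by blast
  have lim: "AE x in unit_leb. (\<lambda>n. g n x) \<longlonglongrightarrow> k x"
    using l(2) k(4) by eventually_elim simp
  have "(\<lambda>n. d + (1/4) ^ n / 4) \<longlonglongrightarrow> d + 0 / 4"
    by (intro tendsto_intros LIMSEQ_realpow_zero) auto
  then have upper: "(\<lambda>n. d + (1/4) ^ n / 4) \<longlonglongrightarrow> d" by simp
  have "(\<lambda>n. sq_dist f (g n)) \<longlonglongrightarrow> d"
    by (rule tendsto_sandwich[OF always_eventually always_eventually tendsto_const upper])
      (use low[OF g(1)] less_imp_le[OF g(2)] in auto)
  note sq_dist_AE_limit_le[of f g, OF f mono_coneD(1)[OF g(1)] measurable_mono_on_unit_leb[OF k(1)] lim this]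
  then show ?thesis using k low by (intro exI[of _ k]) (auto simp: mono_cone_def intro: order_trans)
qed

lemma proj_mono_spec:
  assumes f: "sq_int f"
  shows "proj_mono f \<in> mono_cone" "right_continuous_01 (proj_mono f)"
    "x \<notin> {0<..<1} \<Longrightarrow> proj_mono f x = 0"
    "h \<in> mono_cone \<Longrightarrow> sq_dist f (proj_mono f) \<le> sq_dist f h"
proof -
  let ?P = "\<lambda>g. g \<in> mono_cone \<and> right_continuous_01 g \<and> (\<forall>x. x \<notin> {0<..<1} \<longrightarrow> g x = 0) \<and>
     (\<forall>h\<in>mono_cone. sq_dist f g \<le> sq_dist f h)"
  have "g = h" if "?P g" "?P h" for g h
  proof
    fix x
    have "sq_dist g h \<le> 2 * (sq_dist f g - sq_dist f g) + 2 * (sq_dist f h - sq_dist f g)"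
      by (rule near_minimizers_close) (use f that in auto)
    moreover have "sq_dist f h \<le> sq_dist f g" using that by auto
    ultimately have "sq_dist g h \<le> 0" by simp
    then have "AE x in unit_leb. g x - h x = 0"
      using that by (intro sq_int_AE_zero sq_int_diff) (auto dest: mono_coneD)
    then have "AE x in unit_leb. g x = h x" by simp
    then show "g x = h x"
      using that right_continuous_AE_eq[of g h x] by (cases "x \<in> {0<..<1}") auto
  qed
  with proj_mono_exists[OF f] have "\<exists>!g. ?P g" by blast
  from theI'[OF this] have "?P (proj_mono f)" unfolding proj_mono_def .
  then show "proj_mono f \<in> mono_cone" "right_continuous_01 (proj_mono f)"
    "x \<notin> {0<..<1} \<Longrightarrow> proj_mono f x = 0"
    "h \<in> mono_cone \<Longrightarrow> sq_dist f (proj_mono f) \<le> sq_dist f h" by auto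
qed

section \<open>The primitive of the projection as a convex envelope\<close>

text \<open>
  First variation: moving from the minimiser in an admissible direction cannot decrease the
  distance to first order.
\<close>
lemma proj_mono_variation:
  assumes f: "sq_int f" and k: "sq_int k"
    and dir: "\<And>e. 0 < e \<Longrightarrow> e < 1 \<Longrightarrow> (\<lambda>x. proj_mono f x + e * k x) \<in> mono_cone"
  shows "(LINT x|unit_leb. (f x - proj_mono f x) * k x) \<le> 0"
proof (rule ccontr)
  define r where "r x = f x - proj_mono f x" for x
  define A B where "A = (LINT x|unit_leb. r x * k x)" and "B = (LINT x|unit_leb. (k x)\<^sup>2)"
  assume "\<not> ?thesis"
  then have A: "0 < A" by (simp add: A_def r_def)
  have B: "0 \<le> B" by (simp add: B_def)
  have r: "sq_int r" unfolding r_def by (intro sq_int_diff f mono_coneD(1)[OF proj_mono_spec(1)])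
  have ineq: "2 * A \<le> e * B" if e: "0 < e" "e < 1" for e
  proof -
    have "(LINT x|unit_leb. (r x)\<^sup>2) \<le> sq_dist r (\<lambda>x. e * k x)"
      using proj_mono_spec(4)[OF f dir[OF e]] by (simp add: r_def algebra_simps)
    also have "\<dots> = (LINT x|unit_leb. (r x)\<^sup>2) - 2 * (LINT x|unit_leb. r x * (e * k x)) + (LINT x|unit_leb. (e * k x)\<^sup>2)"
      by (intro sq_int_sq_diff r sq_int_cmult k)
    also have "(LINT x|unit_leb. r x * (e * k x)) = e * A"
      by (simp add: A_def mult.left_commute)
    also have "(LINT x|unit_leb. (e * k x)\<^sup>2) = e * (e * B)"
      unfolding B_def power_mult_distrib by (simp add: power2_eq_square[of e])
    finally have "e * (2 * A) \<le> e * (e * B)" by simp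
    then show ?thesis using e by simp
  qed
  \<comment> \<open>For this step size the quadratic term \<open>e * B\<close> is at most \<open>A\<close>, hence cannot dominate \<open>2 * A\<close>.\<close>
  define e where "e = min (1/2) (A / (B + 1))"
  have "e * B \<le> A / (B + 1) * (B + 1)" unfolding e_def using A B
    by (intro mult_mono) auto
  then have "e * B \<le> A" using B by simp
  moreover have "0 < e" "e < 1" using A B by (auto simp: e_def)
  ultimately show False using ineq[of e] A by simp
qed

text \<open>
  Both \<open>g\<close> and \<open>- g\<close> are admissible directions at the projection \<open>g\<close>, because the cone is
  invariant under positive scaling.
\<close>
lemma proj_mono_pairing_self:
  assumes f: "sq_int f"
  shows "(LINT x|unit_leb. (f x - proj_mono f x) * proj_mono f x) = 0"
proof (rule antisym)
  note g = proj_mono_spec(1)[OF f]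
  show "(LINT x|unit_leb. (f x - proj_mono f x) * proj_mono f x) \<le> 0"
    by (rule proj_mono_variation[OF f mono_coneD(1)[OF g]]) (intro mono_cone_add mono_cone_cmult g, simp)
  have "(LINT x|unit_leb. (f x - proj_mono f x) * (- 1 * proj_mono f x)) \<le> 0"
  proof (rule proj_mono_variation[OF f sq_int_cmult])
    fix e :: real assume "0 < e" "e < 1"
    then have "(\<lambda>x. (1 - e) * proj_mono f x) \<in> mono_cone" by (intro mono_cone_cmult g) simp
    then show "(\<lambda>x. proj_mono f x + e * (- 1 * proj_mono f x)) \<in> mono_cone"
      by (simp add: algebra_simps)
  qed (rule mono_coneD(1)[OF g])
  then show "0 \<le> (LINT x|unit_leb. (f x - proj_mono f x) * proj_mono f x)" by simp
qed

text \<open>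
  Testing the first variation with the constants of both signs, and with the indicator of
  \<open>{x..<1}\<close>.
\<close>
lemma primitive_proj_mono_le:
  assumes f: "sq_int f"
  shows "primitive (proj_mono f) 1 = primitive f 1"
    and "x \<in> {0..1} \<Longrightarrow> primitive (proj_mono f) x \<le> primitive f x"
proof -
  note g = proj_mono_spec(1)[OF f]
  note int = sq_int_integrable[OF f] sq_int_integrable[OF mono_coneD(1)[OF g]]
  let ?r = "\<lambda>x. f x - proj_mono f x"
  have c: "c * (primitive f 1 - primitive (proj_mono f) 1) \<le> 0" for c
  proof -
    have "(LINT x|unit_leb. ?r x * c) \<le> 0"
      by (rule proj_mono_variation[OF f sq_int_const]) (intro mono_cone_add mono_cone_const g)
    then show ?thesis using int by (simp add: primitive_1 mult.commute)
  qed
  show 1: "primitive (proj_mono f) 1 = primitive f 1" using c[of 1] c[of "-1"] by simp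
  assume x: "x \<in> {0..1}"
  define k :: "real \<Rightarrow> real" where "k w = (if w \<in> {x..<1} then 1 else 0)" for w
  have "mono_on {0<..<1} k" by (intro mono_onI) (auto simp: k_def)
  moreover have "sq_int k"
    unfolding k_def by (intro sq_int_if sq_int_const) simp
  ultimately have k: "k \<in> mono_cone" by (simp add: mono_cone_def)
  have "(LINT w|unit_leb. ?r w * k w) \<le> 0"
    by (rule proj_mono_variation[OF f mono_coneD(1)[OF k]]) (intro mono_cone_add mono_cone_cmult g k, simp)
  then have "primitive ?r 1 - primitive ?r x \<le> 0"
    using x int by (subst primitive_increment) (auto simp: k_def indicator_def of_bool_def mult.commute)
  then show "primitive (proj_mono f) x \<le> primitive f x"
    using 1 int by (simp add: primitive_diff)
qed

lemma primitive_eq_off: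
  assumes int: "integrable unit_leb u" and "p \<le> q"
    and zero: "\<And>w. w \<in> {0<..<1} \<Longrightarrow> w \<notin> {p<..<q} \<Longrightarrow> u w = 0"
    and pq: "0 \<le> p" "q \<le> 1"
  shows "x \<in> {0..p} \<Longrightarrow> primitive u x = 0" "x \<in> {q..1} \<Longrightarrow> primitive u x = primitive u q"
proof -
  have z: "integrable unit_leb (\<lambda>_. 0 :: real)" by simp
  have z0: "primitive (\<lambda>_. 0) y = 0" for y by (simp add: primitive_def)
  show "primitive u x = 0" if "x \<in> {0..p}"
    using primitive_increment_cong[OF int z, of 0 x] zero that \<open>p \<le> q\<close> pq by (auto simp: z0)
  show "primitive u x = primitive u q" if "x \<in> {q..1}"
    using primitive_increment_cong[OF int z, of q x] zero that \<open>p \<le> q\<close> pq by (auto simp: z0)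
qed

text \<open>
  Together with the preceding lemma this identifies the primitive of the projection as the convex
  envelope of the primitive of \<open>f\<close>. Suppose that the primitive \<open>H\<close> of \<open>h\<close> exceeds the primitive \<open>G\<close> of the
  projection \<open>g\<close>, and let \<open>{p<..<q}\<close> be a component of \<open>{H > G}\<close>. The competitor \<open>m\<close> that follows \<open>h\<close> on this
  component and \<open>g\<close> elsewhere is again nondecreasing, and its primitive lies between \<open>G\<close> and the
  primitive of \<open>f\<close>. Hence \<open>f - m\<close> and \<open>m - g\<close> both have nonpositive pairing with \<open>g\<close>; as their sum \<open>f - g\<close> is
  orthogonal to \<open>g\<close>, both pairings vanish. Then \<open>\<integral> (m - g)\<^sup>2 = \<integral> (m - g) m \<le> 0\<close>, and \<open>H = G\<close> on the component.
\<close>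
lemma primitive_le_proj_mono:
  assumes f: "sq_int f" and h: "h \<in> mono_cone"
    and below: "\<And>x. x \<in> {0..1} \<Longrightarrow> primitive h x \<le> primitive f x" and x: "x \<in> {0..1}"
  shows "primitive h x \<le> primitive (proj_mono f) x"
proof (rule ccontr)
  define g where "g = proj_mono f"
  assume "\<not> ?thesis"
  then have less: "primitive g x < primitive h x" by (simp add: g_def)
  have g: "g \<in> mono_cone" unfolding g_def by (rule proj_mono_spec(1)[OF f])
  note sq = f mono_coneD(1)[OF g] mono_coneD(1)[OF h]
  note int = sq[THEN sq_int_integrable]
  define D where "D y = primitive h y - primitive g y" for y
  have "continuous_on {0..1} D" unfolding D_def
    by (intro continuous_intros continuous_on_primitive int)
  moreover have "D 0 \<le> 0" "D 1 \<le> 0" "0 < D x"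
    using below[of 1] primitive_proj_mono_le(1)[OF f] less by (auto simp: D_def g_def)
  ultimately obtain p q where pq: "0 \<le> p" "p < x" "x < q" "q \<le> 1" "D p = 0" "D q = 0"
    and pos: "\<And>y. p < y \<Longrightarrow> y < q \<Longrightarrow> 0 < D y"
    using positive_component[of 0 1 D x] x by metis
  have cross: "\<exists>w. 0 < w \<and> w < 1 \<and> y < w \<and> w < z \<and> k w < k' w"
    if "primitive k z - primitive k y < primitive k' z - primitive k' y" "y \<le> z"
      "integrable unit_leb k" "integrable unit_leb k'" for k k' y z
    using primitive_increment_mono[of k' k y z] that by (force simp: not_less[symmetric])
  define m where "m y = (if y \<in> {p<..<q} then h y else g y)" for y
  have sqm: "sq_int m" unfolding m_def by (rule sq_int_if) (use sq in auto)
  have "mono_on {0<..<1} m"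
  proof (rule mono_onI)
    fix y z :: real assume yz: "y \<in> {0<..<1}" "z \<in> {0<..<1}" "y \<le> z"
    consider "y \<notin> {p<..<q}" "z \<notin> {p<..<q}" | "y \<in> {p<..<q}" "z \<in> {p<..<q}"
      | "y \<in> {p<..<q}" "q \<le> z" | "y \<le> p" "z \<in> {p<..<q}"
      using yz by fastforce
    \<comment> \<open>Across an end point of the component the sign of the increment of \<open>D\<close> yields an
       intermediate point at which \<open>h\<close> and \<open>g\<close> compare in the required direction.\<close>
    then show "m y \<le> m z"
    proof cases
      case 1 then show ?thesis using yz mono_onD[OF mono_coneD(2)[OF g]] by (auto simp: m_def)
    next
      case 2 then show ?thesis using yz mono_onD[OF mono_coneD(2)[OF h]] by (auto simp: m_def)
    next
      case 3
      then have "primitive h q - primitive h y < primitive g q - primitive g y"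
        using pos[of y] pq by (simp add: D_def)
      from cross[OF this] 3 int obtain w where w: "0 < w" "w < 1" "y < w" "w < q" "h w < g w" by auto
      have "h y \<le> h w" "g w \<le> g z"
        using yz w 3 by (auto intro!: mono_onD[OF mono_coneD(2)[OF g]] mono_onD[OF mono_coneD(2)[OF h]])
      then show ?thesis using 3 w by (auto simp: m_def)
    next
      case 4
      then have "primitive g z - primitive g p < primitive h z - primitive h p"
        using pos[of z] pq by (simp add: D_def)
      from cross[OF this] 4 int obtain w where w: "0 < w" "w < 1" "p < w" "w < z" "g w < h w" by auto
      have "g y \<le> g w" "h w \<le> h z"
        using yz w 4 by (auto intro!: mono_onD[OF mono_coneD(2)[OF g]] mono_onD[OF mono_coneD(2)[OF h]])
      then show ?thesis using 4 w by (auto simp: m_def)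
    qed
  qed
  note m = sqm this
  define u where "u y = m y - g y" for y
  have squ: "sq_int u" unfolding u_def by (intro sq_int_diff sq m)
  note intu = sq_int_integrable[OF squ]
  have off: "\<And>w. w \<notin> {p<..<q} \<Longrightarrow> u w = 0" by (auto simp: u_def m_def)
  have "p \<le> q" using pq by simp
  note left = primitive_eq_off(1)[OF intu this off pq(1) pq(4)] and right = primitive_eq_off(2)[OF intu this off pq(1) pq(4)]
  have inside: "primitive u y = D y" if "p \<le> y" "y \<le> q" for y
  proof -
    have "primitive u y - primitive u p = primitive (\<lambda>w. h w - g w) y - primitive (\<lambda>w. h w - g w) p"
      by (rule primitive_increment_cong) (use intu int that in \<open>auto simp: u_def m_def\<close>)
    moreover have "primitive u p = 0" using left[of p] pq by simp
    ultimately show ?thesis using int pq by (simp add: primitive_diff D_def)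
  qed
  have u_cases: "(p \<le> y \<and> y \<le> q \<and> primitive u y = D y) \<or> primitive u y = 0" if "y \<in> {0..1}" for y
    using left[of y] right[of y] inside[of y] inside[of q] pq that by force
  have u1: "primitive u 1 = 0" using right[of 1] inside[of q] pq by simp
  have u_nonneg: "0 \<le> primitive u y" if "y \<in> {0..1}" for y
    using u_cases[OF that] pos[of y] pq by (cases "y = p \<or> y = q") fastforce+
  have um: "(LINT y|unit_leb. u y * m y) \<le> 0"
    by (rule monotone_pairing_nonpos[OF squ m u_nonneg u1])
  have ug: "(LINT y|unit_leb. u y * g y) \<le> 0"
    by (rule monotone_pairing_nonpos[OF squ mono_coneD[OF g] u_nonneg u1])
  have prim_fm: "primitive (\<lambda>y. f y - m y) y = primitive f y - primitive g y - primitive u y" for y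
    using int sq_int_integrable[OF sqm] primitive_diff[of m g y] by (simp add: primitive_diff u_def[abs_def])
  have "(LINT y|unit_leb. (f y - m y) * g y) \<le> 0"
  proof (rule monotone_pairing_nonpos[OF sq_int_diff[OF f sqm] mono_coneD[OF g]])
    fix y :: real assume y: "y \<in> {0..1}"
    show "0 \<le> primitive (\<lambda>y. f y - m y) y"
      using u_cases[OF y] below[OF y] primitive_proj_mono_le(2)[OF f y]
      by (auto simp: prim_fm D_def g_def)
  qed (use u1 primitive_proj_mono_le(1)[OF f] in \<open>simp add: prim_fm g_def\<close>)
  moreover have "(LINT y|unit_leb. (f y - m y) * g y) + (LINT y|unit_leb. u y * g y) = (LINT y|unit_leb. (f y - g y) * g y)"
    using sq m by (subst Bochner_Integration.integral_add[symmetric])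
      (auto intro!: sq_int_mult_integrable sq_int_diff squ Bochner_Integration.integral_cong simp: u_def algebra_simps)
  ultimately have ug': "0 \<le> (LINT y|unit_leb. u y * g y)"
    using proj_mono_pairing_self[OF f] ug by (simp add: g_def)
  have "(LINT y|unit_leb. (u y)\<^sup>2) = (LINT y|unit_leb. u y * m y) - (LINT y|unit_leb. u y * g y)"
    using sq m by (subst Bochner_Integration.integral_diff[symmetric])
      (auto intro!: sq_int_mult_integrable squ Bochner_Integration.integral_cong simp: u_def algebra_simps power2_eq_square)
  then have "AE y in unit_leb. u y = 0"
    using um ug' by (intro sq_int_AE_zero squ) simp
  then have "primitive u x = primitive (\<lambda>_. 0) x"
    by (intro primitive_cong_AE) (use sq_int_measurable[OF squ] in auto)
  then have "primitive u x = 0" by (simp add: primitive_def)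
  then show False using inside[of x] pos[of x] pq by simp
qed

section \<open>The Wasserstein distance and first moments\<close>

text \<open>
  The triangle inequality under a coupling of small cost. For push-forwards of the unit interval it
  turns closeness in the Wasserstein distance into a bound on the \<open>L\<^sup>1\<close> norms of the maps.
\<close>
lemma nn_integral_abs_le_W1:
  assumes "W1 \<mu> \<nu> < c"
  shows "(\<integral>\<^sup>+ y. ennreal \<bar>y\<bar> \<partial>\<mu>) \<le> (\<integral>\<^sup>+ y. ennreal \<bar>y\<bar> \<partial>\<nu>) + c"
proof -
  obtain \<pi> where \<pi>: "sets \<pi> = sets borel" "distr \<pi> borel fst = \<mu>" "distr \<pi> borel snd = \<nu>"
    and less: "(\<integral>\<^sup>+ p. ennreal \<bar>fst p - snd p\<bar> \<partial>\<pi>) < c"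
    using assms unfolding W1_def INF_less_iff couplings_def by auto
  have [measurable]: "fst \<in> \<pi> \<rightarrow>\<^sub>M (borel :: real measure)" "snd \<in> \<pi> \<rightarrow>\<^sub>M (borel :: real measure)"
    unfolding measurable_cong_sets[OF \<pi>(1) refl]
    by (auto intro!: borel_measurable_continuous_onI continuous_intros)
  have "(\<integral>\<^sup>+ y. ennreal \<bar>y\<bar> \<partial>\<mu>) = (\<integral>\<^sup>+ p. ennreal \<bar>fst p\<bar> \<partial>\<pi>)"
    unfolding \<pi>(2)[symmetric] by (rule nn_integral_distr) measurable
  also have "\<dots> \<le> (\<integral>\<^sup>+ p. ennreal \<bar>snd p\<bar> + ennreal \<bar>fst p - snd p\<bar> \<partial>\<pi>)"
    by (intro nn_integral_mono) (simp flip: ennreal_plus)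
  also have "\<dots> = (\<integral>\<^sup>+ p. ennreal \<bar>snd p\<bar> \<partial>\<pi>) + (\<integral>\<^sup>+ p. ennreal \<bar>fst p - snd p\<bar> \<partial>\<pi>)"
    by (rule nn_integral_add) measurable
  also have "(\<integral>\<^sup>+ p. ennreal \<bar>snd p\<bar> \<partial>\<pi>) = (\<integral>\<^sup>+ y. ennreal \<bar>y\<bar> \<partial>\<nu>)"
    unfolding \<pi>(3)[symmetric] by (rule nn_integral_distr[symmetric]) measurable
  finally show ?thesis using less by (meson add_left_mono less_imp_le order_trans)
qed

lemma W1_self:
  assumes "sets \<mu> = sets borel" shows "W1 \<mu> \<mu> = 0"
proof -
  define \<pi> where "\<pi> = distr \<mu> borel (\<lambda>x. (x, x))"
  have [measurable]: "(\<lambda>x. (x, x)) \<in> \<mu> \<rightarrow>\<^sub>M (borel :: (real \<times> real) measure)"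
    unfolding measurable_cong_sets[OF assms refl]
    by (intro borel_measurable_continuous_onI continuous_intros)
  have [measurable]: "fst \<in> borel \<rightarrow>\<^sub>M (borel :: real measure)" "snd \<in> borel \<rightarrow>\<^sub>M (borel :: real measure)"
    by (auto intro!: borel_measurable_continuous_onI continuous_intros)
  have "\<pi> \<in> couplings \<mu> \<mu>"
    using assms distr_id2[of borel \<mu>] unfolding couplings_def \<pi>_def
    by (auto simp: distr_distr comp_def)
  moreover have "(\<integral>\<^sup>+ p. ennreal \<bar>fst p - snd p\<bar> \<partial>\<pi>) = 0"
    unfolding \<pi>_def by (subst nn_integral_distr) auto
  ultimately show ?thesis
    using INF_lower[of \<pi> "couplings \<mu> \<mu>" "\<lambda>\<pi>. \<integral>\<^sup>+ p. ennreal \<bar>fst p - snd p\<bar> \<partial>\<pi>"]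
    by (simp add: W1_def)
qed

lemma eventually_linear_bound_nonneg:
  fixes c K :: real
  assumes "\<forall>\<^sub>F t in at_top. K \<le> t * c" shows "0 \<le> c"
proof (rule ccontr)
  assume "\<not> 0 \<le> c"
  obtain t0 where "\<And>t. t0 \<le> t \<Longrightarrow> K \<le> t * c"
    using assms unfolding eventually_at_top_linorder by auto
  from this[of "max t0 (K / c + 1)"] have "K \<le> max t0 (K / c + 1) * c" by simp
  also have "\<dots> \<le> (K / c + 1) * c" using \<open>\<not> 0 \<le> c\<close> by (intro mult_right_mono_neg) auto
  also have "\<dots> = K + c" using \<open>\<not> 0 \<le> c\<close> by (simp add: field_simps)
  finally show False using \<open>\<not> 0 \<le> c\<close> by simp
qed

lemma abs_primitive_le:
  assumes "integrable unit_leb g"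
  shows "\<bar>primitive g x\<bar> \<le> (LINT w|unit_leb. \<bar>g w\<bar>)"
proof -
  have "\<bar>primitive g x\<bar> \<le> (LINT w|unit_leb. \<bar>indicator {..<x} w * g w\<bar>)"
    unfolding primitive_def by (rule integral_abs_bound)
  also have "\<dots> \<le> (LINT w|unit_leb. \<bar>g w\<bar>)"
    using assms by (intro integral_mono integrable_abs integrable_indicator_unit_leb)
      (auto simp: indicator_def)
  finally show ?thesis .
qed

section \<open>Sticky particle maps\<close>

text \<open>
  The initial data of a sticky particle solution in Lagrangian form. In this locale, \<open>G t\<close> is the
  convex envelope of \<open>\<Phi> t = primitive N + t * primitive V\<close>; the lemmas below use it through three properties:
  it lies below \<open>\<Phi> t\<close>, it agrees with \<open>\<Phi> t\<close> at \<open>1\<close>, and it is the greatest primitive below \<open>\<Phi> t\<close>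
  of a nondecreasing square integrable function.
\<close>
locale sticky_data =
  fixes N V :: "real \<Rightarrow> real"
  assumes N_sq: "sq_int N" and N_mono: "mono_on {0<..<1} N" and V_sq: "sq_int V"
begin

abbreviation "g t \<equiv> sticky_map N V t"
abbreviation "G t \<equiv> primitive (g t)"

lemmas N_int = sq_int_integrable[OF N_sq]
lemmas V_int = sq_int_integrable[OF V_sq]

lemma moved_sq: "sq_int (\<lambda>x. N x + t * V x)"
  by (intro sq_int_add sq_int_cmult N_sq V_sq)

lemma primitive_moved: "primitive (\<lambda>x. N x + t * V x) x = primitive N x + t * primitive V x"
  using N_int V_int by (subst primitive_add) (auto simp: primitive_cmult)

lemma map_cone: "g t \<in> mono_cone"
  unfolding sticky_map_def by (rule proj_mono_spec(1)[OF moved_sq])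

lemma map_sq: "sq_int (g t)" and map_mono: "mono_on {0<..<1} (g t)"
  using mono_coneD[OF map_cone] by auto

lemmas map_int = sq_int_integrable[OF map_sq]

lemma map_right_continuous: "right_continuous_01 (g t)"
  unfolding sticky_map_def by (rule proj_mono_spec(2)[OF moved_sq])

lemma map_outside: "x \<notin> {0<..<1} \<Longrightarrow> g t x = 0"
  unfolding sticky_map_def by (rule proj_mono_spec(3)[OF moved_sq])

lemma map_primitive_le: "x \<in> {0..1} \<Longrightarrow> G t x \<le> primitive N x + t * primitive V x"
  using primitive_proj_mono_le(2)[OF moved_sq] by (simp add: sticky_map_def primitive_moved)

lemma map_primitive_1: "G t 1 = primitive N 1 + t * primitive V 1"
  using primitive_proj_mono_le(1)[OF moved_sq] by (simp add: sticky_map_def primitive_moved)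

lemma map_primitive_greatest:
  assumes "h \<in> mono_cone" "\<And>y. y \<in> {0..1} \<Longrightarrow> primitive h y \<le> primitive N y + t * primitive V y"
    "x \<in> {0..1}"
  shows "primitive h x \<le> G t x"
  using primitive_le_proj_mono[OF moved_sq assms(1) _ assms(3)] assms(2)
  by (simp add: sticky_map_def primitive_moved)

lemma map_eqI:
  assumes "AE x in unit_leb. g s x = g t x" shows "g s = g t"
proof
  fix x
  show "g s x = g t x"
  proof (cases "x \<in> {0<..<1}")
    case True
    then show ?thesis
      by (rule right_continuous_AE_eq[OF map_right_continuous map_right_continuous assms])
  qed (simp add: map_outside)
qed

text \<open>
  At equilibrium the maps \<open>g t\<close> are bounded in \<open>L\<^sup>1\<close> for large \<open>t\<close>, hence so are their primitives. Because
  these lie below \<open>\<Phi> t\<close>, the coefficient of \<open>t\<close> in \<open>\<Phi> t\<close> cannot be negative anywhere; because they agree with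
  \<open>\<Phi> t\<close> at \<open>1\<close>, it cannot be positive there.
\<close>
lemma equilibrium_imp_velocity:
  assumes "goes_to_equilibrium (sticky_solution N V)"
  shows "primitive V 1 = 0" "\<And>x. x \<in> {0..1} \<Longrightarrow> 0 \<le> primitive V x"
proof -
  obtain \<nu> where "\<nu> \<in> P2" and lim: "((\<lambda>t. W1 (sticky_solution N V t) \<nu>) \<longlongrightarrow> 0) at_top"
    using assms unfolding goes_to_equilibrium_def converges_to_equilibrium_def by auto
  then have \<nu>: "real_distribution \<nu>" "integrable \<nu> (\<lambda>y. y\<^sup>2)" by (auto simp: P2_def)
  interpret \<nu>: real_distribution \<nu> by (rule \<nu>)
  have "integrable \<nu> (\<lambda>y. \<bar>y\<bar>)"
  proof (rule Bochner_Integration.integrable_bound[where f="\<lambda>y. 1 + y\<^sup>2"])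
    have "\<bar>y\<bar> \<le> 1 + y\<^sup>2" for y :: real
      using sum_power2_ge_zero[of "\<bar>y\<bar> - 1" 0] zero_le_power2[of y] by (simp add: power2_diff)
    then show "AE y in \<nu>. norm \<bar>y\<bar> \<le> norm (1 + y\<^sup>2)" by simp
  qed (use \<nu> in auto)
  then have fin: "(\<integral>\<^sup>+ y. ennreal \<bar>y\<bar> \<partial>\<nu>) = ennreal (LINT y|\<nu>. \<bar>y\<bar>)"
    by (intro nn_integral_eq_integral) auto
  define C where "C = (LINT y|\<nu>. \<bar>y\<bar>) + 1"
  have "0 \<le> C" by (auto simp: C_def intro!: add_nonneg_nonneg)
  have "\<forall>\<^sub>F t in at_top. W1 (sticky_solution N V t) \<nu> < 1"
    using lim by (rule order_tendstoD) simp
  then have bound: "\<forall>\<^sub>F t in at_top. (LINT w|unit_leb. \<bar>g t w\<bar>) \<le> C"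
  proof eventually_elim
    case (elim t)
    note [measurable] = sq_int_measurable[OF map_sq]
    have "ennreal (LINT w|unit_leb. \<bar>g t w\<bar>) = (\<integral>\<^sup>+ w. ennreal \<bar>g t w\<bar> \<partial>unit_leb)"
      using map_int by (intro nn_integral_eq_integral[symmetric]) auto
    also have "\<dots> = (\<integral>\<^sup>+ y. ennreal \<bar>y\<bar> \<partial>sticky_solution N V t)"
      unfolding sticky_solution_def by (rule nn_integral_distr[symmetric]) measurable
    also have "\<dots> \<le> ennreal (LINT y|\<nu>. \<bar>y\<bar>) + 1"
      using nn_integral_abs_le_W1[OF elim] by (simp add: fin)
    also have "\<dots> = ennreal C"
      by (simp add: C_def ennreal_plus flip: ennreal_1)
    finally show ?case using \<open>0 \<le> C\<close> by simp
  qed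
  have nonneg: "0 \<le> primitive V x" if x: "x \<in> {0..1}" for x
  proof (rule eventually_linear_bound_nonneg)
    show "\<forall>\<^sub>F t in at_top. - C - primitive N x \<le> t * primitive V x"
      using bound
    proof eventually_elim
      case (elim t)
      then show ?case using abs_primitive_le[OF map_int, of t x] map_primitive_le[OF x, of t] by linarith
    qed
  qed
  have "0 \<le> - primitive V 1"
  proof (rule eventually_linear_bound_nonneg)
    show "\<forall>\<^sub>F t in at_top. - C + primitive N 1 \<le> t * - primitive V 1"
      using bound
    proof eventually_elim
      case (elim t)
      then show ?case using abs_primitive_le[OF map_int, of t 1] map_primitive_1[of t] by simp
    qed
  qed
  with nonneg[of 1] show "primitive V 1 = 0" by simp
  show "0 \<le> primitive V x" if "x \<in> {0..1}" for x using nonneg[OF that] .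
qed

text \<open>
  Equality of the measures is equality of the maps, by uniqueness of the optimal map. Conversely,
  maps that stay constant supply their own equilibrium.
\<close>
lemma collapsed_from_iff:
  "collapsed_from (sticky_solution N V) T \<longleftrightarrow> 0 \<le> T \<and> (\<forall>t\<ge>T. g t = g T)"
proof
  assume c: "collapsed_from (sticky_solution N V) T"
  then obtain \<nu> where \<nu>: "\<And>t. T \<le> t \<Longrightarrow> sticky_solution N V t = \<nu>"
    unfolding collapsed_from_def by auto
  have "g t = g T" if "T \<le> t" for t
  proof
    fix x
    have "sticky_solution N V t = sticky_solution N V T"
      using trans[OF \<nu>[OF that] \<nu>[OF order_refl, symmetric]] .
    then have eq: "distr unit_leb borel (g t) = distr unit_leb borel (g T)"
      unfolding sticky_solution_def .
    show "g t x = g T x"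
    proof (cases "x \<in> {0<..<1}")
      case True
      then show ?thesis
        by (rule optimal_map_unique[OF map_mono map_right_continuous map_mono map_right_continuous eq])
    qed (simp add: map_outside)
  qed
  then show "0 \<le> T \<and> (\<forall>t\<ge>T. g t = g T)" using c unfolding collapsed_from_def by blast
next
  assume T: "0 \<le> T \<and> (\<forall>t\<ge>T. g t = g T)"
  define \<nu> where "\<nu> = sticky_solution N V T"
  have \<nu>: "sticky_solution N V t = \<nu>" if "T \<le> t" for t
  proof -
    have "g t = g T" using T that by blast
    then show ?thesis by (simp only: \<nu>_def sticky_solution_def)
  qed
  note [measurable] = sq_int_measurable[OF map_sq]
  have "real_distribution \<nu>"
    unfolding \<nu>_def sticky_solution_def
    by (auto simp: real_distribution_def real_distribution_axioms_def intro!: unit_leb.prob_space_distr)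
  moreover have "integrable \<nu> (\<lambda>y. y\<^sup>2)"
    unfolding \<nu>_def sticky_solution_def using map_sq[of T]
    by (subst integrable_distr_eq) (auto simp: square_integrable_def)
  ultimately have "\<nu> \<in> P2" by (simp add: P2_def)
  moreover have "((\<lambda>t. W1 (sticky_solution N V t) \<nu>) \<longlongrightarrow> 0) at_top"
  proof (rule tendsto_eventually)
    show "\<forall>\<^sub>F t in at_top. W1 (sticky_solution N V t) \<nu> = 0"
      using eventually_ge_at_top[of T]
      by eventually_elim (simp add: \<nu>, simp add: \<nu>_def sticky_solution_def W1_self)
  qed
  ultimately show "collapsed_from (sticky_solution N V) T"
    using T \<nu> unfolding collapsed_from_def converges_to_equilibrium_def by blast
qed

section \<open>The time of collapse\<close>

text \<open>
  The intervals over which the supremum in the theorem runs. The particles in such an interval have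
  total momentum zero, while every proper initial segment of them has positive momentum: they are
  driven together, and at equilibrium they form a single particle at rest.
\<close>
definition stationary_pair :: "real \<Rightarrow> real \<Rightarrow> bool" where
  "stationary_pair a b \<longleftrightarrow> 0 \<le> a \<and> a < b \<and> b \<le> 1 \<and> primitive V a = 0 \<and> primitive V b = 0 \<and>
     (\<forall>x\<in>{a<..<b}. 0 < primitive V x)"

text \<open>
  The height of the chord of the convex function \<open>primitive N\<close> over \<open>{a..b}\<close> above its graph
  at \<open>x\<close>.
\<close>
definition chord_gap :: "real \<Rightarrow> real \<Rightarrow> real \<Rightarrow> real" where
  "chord_gap a b x = primitive N b - primitive N x + (x - b) / (b - a) * (primitive N b - primitive N a)"

lemma chord_gap_nonneg:
  assumes "stationary_pair a b" "x \<in> {a<..<b}" shows "0 \<le> chord_gap a b x"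
  using primitive_chord[OF N_int N_mono, of a x b] assms
  by (auto simp: stationary_pair_def chord_gap_def)

text \<open>
  The envelope \<open>G t\<close> lies below \<open>\<Phi> 0 = primitive N\<close> wherever \<open>primitive V\<close> vanishes, and by convexity below
  the chord of \<open>\<Phi> 0\<close> over every stationary interval. If these chords lie below \<open>\<Phi> T\<close>, then \<open>G t \<le> \<Phi> T\<close>
  everywhere, so \<open>G t \<le> G T\<close>. The converse inequality holds because \<open>\<Phi> t\<close> increases with \<open>t\<close>.
\<close>
lemma map_eq_if_gap_le:
  assumes nonneg: "\<And>x. x \<in> {0..1} \<Longrightarrow> 0 \<le> primitive V x" and total: "primitive V 1 = 0"
    and gap: "\<And>a b x. stationary_pair a b \<Longrightarrow> x \<in> {a<..<b} \<Longrightarrow> chord_gap a b x \<le> T * primitive V x"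
    and t: "T \<le> t"
  shows "g t = g T"
proof -
  have below: "G t x \<le> primitive N x + T * primitive V x" if x: "x \<in> {0..1}" for x
  proof (cases "primitive V x = 0")
    case True then show ?thesis using map_primitive_le[OF x, of t] by simp
  next
    case False
    then have "0 < primitive V x" using nonneg[OF x] by simp
    then obtain a b where ab: "0 \<le> a" "a < x" "x < b" "b \<le> 1" "primitive V a = 0" "primitive V b = 0"
      "\<And>y. a < y \<Longrightarrow> y < b \<Longrightarrow> 0 < primitive V y"
      using positive_component[OF continuous_on_primitive[OF V_int], of x] x total by auto
    then have pair: "stationary_pair a b" by (auto simp: stationary_pair_def)
    have combine: "q + (x - b) / (b - a) * (q - p) = (x - a) / (b - a) * q + (b - x) / (b - a) * p" for p q :: real
    proof -
      have "(x - a) / (b - a) = 1 + (x - b) / (b - a)" "(b - x) / (b - a) = - ((x - b) / (b - a))"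
        using ab by (simp_all add: field_simps)
      moreover have "q + r * (q - p) = (1 + r) * q + (- r) * p" for r :: real
        by (simp add: algebra_simps)
      ultimately show ?thesis by (simp only:)
    qed
    have "G t x \<le> G t b + (x - b) / (b - a) * (G t b - G t a)"
      by (rule primitive_chord[OF map_int map_mono]) (use ab in auto)
    also have "\<dots> \<le> (x - a) / (b - a) * primitive N b + (b - x) / (b - a) * primitive N a"
      unfolding combine
      using map_primitive_le[of a t] map_primitive_le[of b t] ab
      by (intro add_mono mult_left_mono) auto
    also have "\<dots> = primitive N x + chord_gap a b x"
      unfolding combine[symmetric] chord_gap_def by simp
    finally show ?thesis using gap[OF pair, of x] ab by simp
  qed
  have mono_t: "G T x \<le> primitive N x + t * primitive V x" if "x \<in> {0..1}" for x
    using map_primitive_le[OF that, of T] mult_right_mono[OF t nonneg[OF that]] by linarith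
  have "AE x in unit_leb. g t x = g T x"
  proof (rule AE_eq_if_primitive_eq_mono[OF map_sq map_mono map_sq map_mono])
    fix x :: real assume "x \<in> {0..1}"
    then show "G t x = G T x"
      using map_primitive_greatest[OF map_cone below] map_primitive_greatest[OF map_cone mono_t]
      by (intro antisym) auto
  qed
  then show ?thesis by (rule map_eqI)
qed

text \<open>
  The initial map after all particles in \<open>{p<..<q}\<close> have merged at their centre of mass; its
  primitive replaces \<open>primitive N\<close> by its chord over \<open>{p..q}\<close>.
\<close>
definition flatten :: "real \<Rightarrow> real \<Rightarrow> real \<Rightarrow> real" where
  "flatten p q w = (if w \<in> {p<..<q} then (primitive N q - primitive N p) / (q - p) else N w)"

lemma flatten_cone:
  assumes pq: "0 \<le> p" "p < q" "q \<le> 1"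
  shows "flatten p q \<in> mono_cone"
proof -
  define c where "c = (primitive N q - primitive N p) / (q - p)"
  have const: "primitive (\<lambda>_. d) q - primitive (\<lambda>_. d) p = d * (q - p)" for d
    using pq by (simp add: primitive_const algebra_simps)
  have lower: "N w \<le> c" if "0 < w" "w \<le> p" for w
  proof -
    have "primitive (\<lambda>_. N w) q - primitive (\<lambda>_. N w) p \<le> primitive N q - primitive N p"
      by (rule primitive_increment_mono) (use that pq N_int in \<open>auto intro!: mono_onD[OF N_mono]\<close>)
    then show ?thesis using pq by (simp add: const c_def field_simps)
  qed
  have upper: "c \<le> N w" if "q \<le> w" "w < 1" for w
  proof -
    have "primitive N q - primitive N p \<le> primitive (\<lambda>_. N w) q - primitive (\<lambda>_. N w) p"
      by (rule primitive_increment_mono) (use that pq N_int in \<open>auto intro!: mono_onD[OF N_mono]\<close>)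
    then show ?thesis using pq by (simp add: const c_def field_simps)
  qed
  have "mono_on {0<..<1} (flatten p q)"
  proof (rule mono_onI)
    fix y z :: real assume yz: "y \<in> {0<..<1}" "z \<in> {0<..<1}" "y \<le> z"
    then have "N y \<le> N z" by (intro mono_onD[OF N_mono])
    then show "flatten p q y \<le> flatten p q z"
      unfolding flatten_def c_def[symmetric]
      using yz lower[of y] upper[of z] by auto
  qed
  moreover have "sq_int (flatten p q)"
    unfolding flatten_def by (rule sq_int_if[OF sq_int_const N_sq]) simp
  ultimately show ?thesis by (simp add: mono_cone_def)
qed

lemma primitive_flatten:
  assumes pq: "0 \<le> p" "p < q" "q \<le> 1" and y: "y \<in> {0..1}"
  shows "y \<in> {p..q} \<Longrightarrow> primitive (flatten p q) y = primitive N q + (y - q) / (q - p) * (primitive N q - primitive N p)"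
    "y \<notin> {p..q} \<Longrightarrow> primitive (flatten p q) y = primitive N y"
proof -
  define c where "c = (primitive N q - primitive N p) / (q - p)"
  note int = sq_int_integrable[OF mono_coneD(1)[OF flatten_cone[OF pq]]]
  have cong: "primitive (flatten p q) z - primitive (flatten p q) w = primitive N z - primitive N w"
    if "w \<le> z" "z \<le> p \<or> q \<le> w" for w z
    by (rule primitive_increment_cong) (use that int N_int in \<open>auto simp: flatten_def\<close>)
  have left: "primitive (flatten p q) w = primitive N w" if "0 \<le> w" "w \<le> p" for w
    using cong[of 0 w] that by simp
  have mid: "primitive (flatten p q) w = primitive N p + c * (w - p)" if "p \<le> w" "w \<le> q" for w
  proof -
    have "primitive (flatten p q) w - primitive (flatten p q) p = primitive (\<lambda>_. c) w - primitive (\<lambda>_. c) p"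
      by (rule primitive_increment_cong) (use that int in \<open>auto simp: flatten_def c_def\<close>)
    then show ?thesis using left[of p] that pq by (simp add: primitive_const algebra_simps)
  qed
  have cq: "c * (q - p) = primitive N q - primitive N p" using pq by (simp add: c_def)
  show "primitive (flatten p q) y = primitive N q + (y - q) / (q - p) * (primitive N q - primitive N p)" if "y \<in> {p..q}"
  proof -
    have "primitive (flatten p q) y = primitive N p + c * (q - p) + c * (y - q)"
      using mid[of y] that by (simp add: algebra_simps)
    also have "\<dots> = primitive N q + c * (y - q)" by (simp add: cq)
    finally show ?thesis by (simp add: c_def mult.commute)
  qed
  show "primitive (flatten p q) y = primitive N y" if "y \<notin> {p..q}"
  proof (cases "y < p")
    case True then show ?thesis using left y by auto
  next
    case False
    then have "q \<le> y" using that by auto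
    moreover have "primitive (flatten p q) q = primitive N q"
      using mid[of q] cq pq by simp
    ultimately show ?thesis using cong[of q y] by simp
  qed
qed

text \<open>
  On the compact interval \<open>{p..q}\<close> the positive function \<open>primitive V\<close> is bounded away from zero, so \<open>\<Phi> t\<close>
  eventually rises above the chord there. The primitive of \<open>flatten p q\<close> is then below \<open>\<Phi> t\<close>, hence below
  its envelope \<open>G t = G T\<close>, which lies below \<open>\<Phi> T\<close>.
\<close>
lemma chord_le_if_constant:
  assumes nonneg: "\<And>x. x \<in> {0..1} \<Longrightarrow> 0 \<le> primitive V x"
    and const: "\<And>t. T \<le> t \<Longrightarrow> g t = g T" and "0 \<le> T"
    and pq: "0 \<le> p" "p < q" "q \<le> 1" and pos: "\<And>x. x \<in> {p..q} \<Longrightarrow> 0 < primitive V x"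
    and x: "x \<in> {p..q}"
  shows "primitive N q + (x - q) / (q - p) * (primitive N q - primitive N p) \<le> primitive N x + T * primitive V x"
proof -
  let ?h = "flatten p q"
  have sub: "{p..q} \<subseteq> {0..1}" using pq by auto
  have ne: "{p..q} \<noteq> {}" using pq by auto
  have int: "integrable unit_leb ?h" by (rule sq_int_integrable[OF mono_coneD(1)[OF flatten_cone[OF pq]]])
  have cont: "continuous_on {p..q} (primitive u)" if "integrable unit_leb u" for u
    by (rule continuous_on_subset[OF continuous_on_primitive[OF that] sub])
  obtain z where z: "z \<in> {p..q}" "\<And>y. y \<in> {p..q} \<Longrightarrow> primitive V z \<le> primitive V y"
    using continuous_attains_inf[OF compact_Icc ne cont[OF V_int]] by blast
  obtain w where w: "\<And>y. y \<in> {p..q} \<Longrightarrow> primitive ?h y - primitive N y \<le> primitive ?h w - primitive N w"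
    using continuous_attains_sup[OF compact_Icc ne continuous_on_diff[OF cont[OF int] cont[OF N_int]]] by blast
  define B where "B = primitive ?h w - primitive N w"
  define t where "t = max T (B / primitive V z)"
  have "0 < primitive V z" using pos z by blast
  have t: "0 \<le> t" "T \<le> t" using \<open>0 \<le> T\<close> by (auto simp: t_def)
  have "primitive ?h y \<le> primitive N y + t * primitive V y" if y: "y \<in> {0..1}" for y
  proof (cases "y \<in> {p..q}")
    case True
    have "B = B / primitive V z * primitive V z" using \<open>0 < primitive V z\<close> by simp
    also have "\<dots> \<le> t * primitive V z"
      using \<open>0 < primitive V z\<close> by (intro mult_right_mono) (auto simp: t_def)
    also have "\<dots> \<le> t * primitive V y" using z(2)[OF True] t(1) by (rule mult_left_mono)
    finally show ?thesis using w[OF True] by (simp add: B_def)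
  next
    case False
    then show ?thesis using primitive_flatten(2)[OF pq y] nonneg[OF y] t(1) by simp
  qed
  then have "primitive ?h x \<le> G t x"
    using x sub by (intro map_primitive_greatest flatten_cone pq) auto
  also have "\<dots> = G T x" using const[OF t(2)] by (rule arg_cong)
  also have "\<dots> \<le> primitive N x + T * primitive V x" using x sub by (intro map_primitive_le) auto
  finally show ?thesis using primitive_flatten(1)[OF pq _ x] x sub by auto
qed

text \<open>
  The preceding bound needs intervals on which \<open>primitive V\<close> stays positive up to the end points. It
  is applied to \<open>{a + d..b - d}\<close>, and continuity gives the limit \<open>d \<rightarrow> 0\<close>.
\<close>
lemma gap_le_if_constant:
  assumes nonneg: "\<And>x. x \<in> {0..1} \<Longrightarrow> 0 \<le> primitive V x"
    and const: "\<And>t. T \<le> t \<Longrightarrow> g t = g T" and "0 \<le> T"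
    and pair: "stationary_pair a b" and x: "x \<in> {a<..<b}"
  shows "chord_gap a b x \<le> T * primitive V x"
proof -
  have ab: "0 \<le> a" "a < x" "x < b" "b \<le> 1" using pair x by (auto simp: stationary_pair_def)
  \<comment> \<open>Halving keeps the shrunken intervals nondegenerate up to \<open>d = e\<close>, so that \<open>H\<close> is continuous
     on the closed interval.\<close>
  define e where "e = min (x - a) (b - x) / 2"
  have e: "0 < e" "e < x - a" "e < b - x" using ab by (auto simp: e_def)
  define H where "H d = primitive N (b - d) + (x - (b - d)) / ((b - d) - (a + d)) * (primitive N (b - d) - primitive N (a + d))" for d
  have shrink: "H d \<le> primitive N x + T * primitive V x" if "d \<in> {0<..<e}" for d
    unfolding H_def
  proof (rule chord_le_if_constant[OF nonneg const \<open>0 \<le> T\<close>])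
    show "0 < primitive V y" if "y \<in> {a + d..b - d}" for y
      using pair that \<open>d \<in> {0<..<e}\<close> by (auto simp: stationary_pair_def)
  qed (use that e ab in auto)
  have cont: "continuous_on {0..e} (\<lambda>d. primitive N (b - d))" "continuous_on {0..e} (\<lambda>d. primitive N (a + d))"
    by (rule continuous_on_compose2[OF continuous_on_primitive[OF N_int]];
        use e ab in \<open>auto intro!: continuous_intros\<close>)+
  have "continuous_on {0..e} H"
    unfolding H_def by (intro continuous_intros cont) (use e ab in auto)
  then have "H 0 \<le> primitive N x + T * primitive V x"
    using continuous_le_on_closure[of "{0<..<e}" H 0 "primitive N x + T * primitive V x"] shrink e
    by simp
  then show ?thesis by (simp add: H_def chord_gap_def)
qed

lemma collapsed_from_iff_gap_le:
  assumes equilibrium: "goes_to_equilibrium (sticky_solution N V)"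
  shows "collapsed_from (sticky_solution N V) T \<longleftrightarrow>
    0 \<le> T \<and> (\<forall>a b x. stationary_pair a b \<longrightarrow> x \<in> {a<..<b} \<longrightarrow> chord_gap a b x \<le> T * primitive V x)"
    (is "_ \<longleftrightarrow> 0 \<le> T \<and> ?gap")
proof -
  note velocity = equilibrium_imp_velocity[OF equilibrium]
  have "(\<forall>t\<ge>T. g t = g T) \<longleftrightarrow> ?gap" if "0 \<le> T"
  proof
    assume const: "\<forall>t\<ge>T. g t = g T"
    show ?gap
    proof (intro allI impI)
      fix a b x assume pair: "stationary_pair a b" "x \<in> {a<..<b}"
      show "chord_gap a b x \<le> T * primitive V x"
        by (rule gap_le_if_constant[OF velocity(2) const[rule_format] that pair])
    qed
  next
    assume gap: ?gap
    show "\<forall>t\<ge>T. g t = g T"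
      by (intro allI impI map_eq_if_gap_le[OF velocity(2,1) gap[rule_format]])
  qed
  then show ?thesis unfolding collapsed_from_iff by blast
qed

text \<open>
  Without such a pair the supremum in the theorem would be \<open>-\<infinity>\<close>.
\<close>
lemma stationary_pair_exists:
  assumes equilibrium: "goes_to_equilibrium (sticky_solution N V)" and "\<not> (AE w in unit_leb. V w = 0)"
  shows "\<exists>a b. stationary_pair a b"
proof -
  obtain x where x: "x \<in> {0..1}" "primitive V x \<noteq> 0"
    using AE_zero_if_primitive_zero[OF V_int] assms(2) by blast
  then have "0 < primitive V x" using equilibrium_imp_velocity(2)[OF equilibrium x(1)] by simp
  then obtain a b where "0 \<le> a" "a < x" "x < b" "b \<le> 1" "primitive V a = 0" "primitive V b = 0"
      "\<And>y. a < y \<Longrightarrow> y < b \<Longrightarrow> 0 < primitive V y"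
    using positive_component[OF continuous_on_primitive[OF V_int], of x] x(1)
      equilibrium_imp_velocity(1)[OF equilibrium] by auto
  then have "stationary_pair a b" by (auto simp: stationary_pair_def)
  then show ?thesis by blast
qed

lemma collapse_time_eq:
  assumes equilibrium: "goes_to_equilibrium (sticky_solution N V)" and "\<not> (AE w in unit_leb. V w = 0)"
  shows "collapse_time (sticky_solution N V) =
    (SUP (a, b)\<in>{(a, b). stationary_pair a b}. SUP x\<in>{a<..<b}. ereal (chord_gap a b x / primitive V x))"
    (is "_ = ?S")
proof -
  have pos: "0 < primitive V x" if "stationary_pair a b" "x \<in> {a<..<b}" for a b x
    using that by (auto simp: stationary_pair_def)
  have S_le: "?S \<le> ereal T \<longleftrightarrow>
      (\<forall>a b x. stationary_pair a b \<longrightarrow> x \<in> {a<..<b} \<longrightarrow> chord_gap a b x \<le> T * primitive V x)" for T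
  proof -
    have "?S \<le> ereal T \<longleftrightarrow>
      (\<forall>a b x. stationary_pair a b \<longrightarrow> x \<in> {a<..<b} \<longrightarrow> chord_gap a b x / primitive V x \<le> T)"
      by (auto simp: SUP_le_iff)
    then show ?thesis using pos by (simp add: pos_divide_le_eq)
  qed
  have iff: "collapsed_from (sticky_solution N V) T \<longleftrightarrow> 0 \<le> T \<and> ?S \<le> ereal T" for T
    unfolding S_le by (rule collapsed_from_iff_gap_le[OF equilibrium])
  have S_nonneg: "0 \<le> ?S"
  proof -
    obtain a b where ab: "stationary_pair a b" using stationary_pair_exists[OF assms] by blast
    define x where "x = (a + b) / 2"
    have x: "x \<in> {a<..<b}" using ab by (auto simp: x_def stationary_pair_def)
    have "0 \<le> ereal (chord_gap a b x / primitive V x)"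
      using chord_gap_nonneg[OF ab x] pos[OF ab x] by simp
    also have "\<dots> \<le> (SUP x\<in>{a<..<b}. ereal (chord_gap a b x / primitive V x))"
      using x by (rule SUP_upper)
    also have "\<dots> \<le> ?S"
      using SUP_upper[of "(a, b)" "{(a, b). stationary_pair a b}"
          "\<lambda>(a, b). SUP x\<in>{a<..<b}. ereal (chord_gap a b x / primitive V x)"] ab by simp
    finally show ?thesis .
  qed
  show ?thesis
  proof (cases ?S)
    case (real s)
    have iff': "collapsed_from (sticky_solution N V) T \<longleftrightarrow> s \<le> T" for T
      using S_nonneg unfolding iff real by auto
    have "(LEAST T. s \<le> T) = s" by (rule Least_equality) auto
    then show ?thesis unfolding collapse_time_def iff' real by auto
  next
    case PInf
    then show ?thesis unfolding collapse_time_def iff by simp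
  next
    case MInf
    then show ?thesis using S_nonneg by simp
  qed
qed

end

theorem theorem3p13:
  fixes \<rho>0 :: "real measure" and v0 N0 V0 F :: "real \<Rightarrow> real"
    and I :: "(real \<times> real) set"
  assumes "\<rho>0 \<in> P2"
    and "square_integrable \<rho>0 v0"
    and "optimal_map \<rho>0 N0"
    and V0_def: "V0 = v0 \<circ> N0"
    and F_def: "F = (\<lambda>x. LBINT w=0..x. V0 w)"
    and "\<not> (AE w in unit_leb. V0 w = 0)"
    and I_def: "I = {(a, b). 0 \<le> a \<and> a < b \<and> b \<le> 1 \<and> F a = 0 \<and> F b = 0 \<and> (\<forall>x\<in>{a<..<b}. F x > 0)}"
    and "goes_to_equilibrium (sticky_solution N0 V0)"
  shows "collapse_time (sticky_solution N0 V0) =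
    (SUP (a, b)\<in>I. SUP x\<in>{a<..<b}.
       ereal (((LBINT w=x..b. N0 w) + (x - b) / (b - a) * (LBINT w=a..b. N0 w))
              / (LBINT w=0..x. V0 w)))"
proof -
  have mono: "mono_on {0<..<1} N0" and push: "distr unit_leb borel N0 = \<rho>0"
    using assms(3) by (auto simp: optimal_map_def)
  note N0_meas = measurable_mono_on_unit_leb[OF mono]
  \<comment> \<open>Pushing the unit interval forward by \<open>N0\<close> transfers square integrability; it is used for the
     velocity and for the identity, which gives the finite second moment.\<close>
  have transfer: "sq_int (h \<circ> N0)" if "square_integrable \<rho>0 h" for h
  proof -
    have h: "h \<in> borel_measurable borel" "integrable (distr unit_leb borel N0) (\<lambda>y. (h y)\<^sup>2)"
      using that unfolding square_integrable_def push[symmetric] by auto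
    then have "integrable unit_leb (\<lambda>x. (h (N0 x))\<^sup>2)"
      using N0_meas by (subst (asm) integrable_distr_eq) auto
    then show ?thesis
      using measurable_comp[OF N0_meas h(1)] by (simp add: square_integrable_def comp_def)
  qed
  have "square_integrable \<rho>0 (\<lambda>y. y)"
    using assms(1) push by (auto simp: P2_def square_integrable_def)
  from transfer[OF this] have "sq_int N0" by (simp add: comp_def)
  moreover have "sq_int V0" unfolding V0_def by (rule transfer[OF assms(2)])
  ultimately interpret sticky_data N0 V0
    by unfold_locales (use mono in auto)
  have F_eq: "(LBINT w=0..x. V0 w) = primitive V0 x" if "x \<in> {0..1}" for x
    using interval_integral_eq_primitive_diff[OF V_int, of 0 x] that by (simp add: zero_ereal_def)
  have I_eq: "I = {(a, b). stationary_pair a b}"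
    unfolding I_def F_def stationary_pair_def by (auto simp: F_eq)
  have gap_eq: "(LBINT w=x..b. N0 w) + (x - b) / (b - a) * (LBINT w=a..b. N0 w) = chord_gap a b x"
    if "stationary_pair a b" "x \<in> {a<..<b}" for a b x
    using that interval_integral_eq_primitive_diff[OF N_int, of x b]
      interval_integral_eq_primitive_diff[OF N_int, of a b]
    by (simp add: stationary_pair_def chord_gap_def)
  show ?thesis
    unfolding collapse_time_eq[OF assms(8,6)] I_eq
  proof (intro SUP_cong refl, clarify, intro SUP_cong refl)
    fix a b x assume "stationary_pair a b" "x \<in> {a<..<b}"
    moreover from this have "x \<in> {0..1}" by (auto simp: stationary_pair_def)
    ultimately show "ereal (chord_gap a b x / primitive V0 x) =
        ereal (((LBINT w=x..b. N0 w) + (x - b) / (b - a) * (LBINT w=a..b. N0 w)) / (LBINT w=0..x. V0 w))"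
      by (simp only: gap_eq F_eq)
  qed
qed

end
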